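(* Let $K$ be a number field of degree $d$ over $\mathbb{Q}$ (not necessarily totally real) with ring of integers $\mathcal{O}_K$ and discriminant $\Delta_K$, let $n\ge d$, and let $\boldsymbol\alpha=(\alpha_1,\dots,\alpha_n)\in K^n$, $\beta\in K$. Then the following are true: (1) $\mathcal{D}(\boldsymbol\alpha)=0$ if and only if $\operatorname{span}_{\mathbb{Q}}\{\alpha_1,\dots,\alpha_n\}\ne K$, and $\mathcal{M}(\boldsymbol\alpha,\beta)=0$ if and only if $\operatorname{span}_{\mathbb{Q}}\{\alpha_1,\dots,\alpha_n,\beta\}\ne K$. (2) If $\boldsymbol\alpha\in\mathcal{O}_K^n$, then either $\mathcal{D}(\boldsymbol\alpha)=0$ or $\mathcal{D}(\boldsymbol\alpha)\ge1$; similarly, if in addition $\beta\in\mathcal{O}_K$, then either $\mathcal{M}(\boldsymbol\alpha,\beta)=0$ or $\mathcal{M}(\boldsymbol\alpha,\beta)\ge1$. Furthermore, in these cases, $\mathcal{D}(\boldsymbol\alpha),\mathcal{M}(\boldsymbol\alpha,\beta)\in\mathbb{Z}_{\ge0}$. (3) $$\mathcal{D}(\boldsymbol\alpha)\le\frac{(d!)^2}{|\Delta_K|}\binom{n}{d}H_K(\boldsymbol\alpha)^2,\qquad \mathcal{M}(\boldsymbol\alpha,\beta)\le\frac{d!}{|\Delta_K|^{1/2}}H_K(\boldsymbol\alpha)H_K(\beta).$$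
   Context: Let $\sigma_1,\dots,\sigma_d$ be the embeddings of $K$ into $\mathbb{C}$. For $\gamma_1,\dots,\gamma_d\in K$ the discriminant is $\det(\sigma_j(\gamma_k))_{1\le j,k\le d}^2$. For integers $m\ge d$ let $\mathcal{J}(m,d)=\{I\subset\{1,\dots,m\}:|I|=d\}$; for a vector $\boldsymbol\gamma\in K^m$ and $I\in\mathcal{J}(m,d)$, $\operatorname{disc}(\boldsymbol\gamma_I)$ denotes the discriminant of the $d$ coordinates of $\boldsymbol\gamma$ indexed by $I$. Let $\boldsymbol\alpha(\beta)=(\alpha_1,\dots,\alpha_n,\beta)\in K^{n+1}$. Define $$\mathcal{D}(\boldsymbol\alpha)=\frac{1}{|\Delta_K|}\sum_{I\in\mathcal{J}(n,d)}|\operatorname{disc}(\boldsymbol\alpha_I)|,\qquad \mathcal{M}(\boldsymbol\alpha,\beta)=\frac{1}{|\Delta_K|^{1/2}}\max_{I\in\mathcal{J}(n+1,d)}|\operatorname{disc}(\boldsymbol\alpha(\beta)_I)|^{1/2}.$$ Let $M(K)$ be the set of places of $K$ and $d_v=[K_v:\mathbb{Q}_v]$ the local degree at $v$. Absolute values are normalized so that the product formula reads $\prod_{v\in M(K)}|a|_v=1$ for all nonzero $a\in K$, i.e. $|\cdot|_v$ is the $d_v$-th power of the absolute value extending the usual (real or $p$-adic) one on $\mathbb{Q}$. For $\boldsymbol\gamma=(\gamma_1,\dots,\gamma_m)\in K^m$ (in particular for a single element, $m=1$) the inhomogeneous height is $$H_K(\boldsymbol\gamma)=\prod_{v\in M(K)}\max\{1,|\gamma_1|_v,\dots,|\gamma_m|_v\}.$$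 *)

theory Defs
  imports
    Complex_Main
    "HOL-Algebra.Embedded_Algebras"
    "HOL-Algebra.QuotRing"
    "Jordan_Normal_Form.Determinant"
begin

section \<open>Number fields\<close>

abbreviation rat_span :: "'a::field_char_0 set \<Rightarrow> 'a set" where
  "rat_span \<equiv> module.span (\<lambda>(q::rat) (x::'a). of_rat q * x)"

class number_field = field_char_0 +
  assumes finite_degree:
    "\<exists>B. finite B \<and> (\<forall>x. \<exists>c. x = (\<Sum>b\<in>B. of_rat (c b) * b))"

instance rat :: number_field
  by standard (rule exI[of _ "{1}"], auto)

definition nf_degree :: "'a::number_field itself \<Rightarrow> nat" where
  "nf_degree _ = vector_space.dim (\<lambda>(q::rat) (x::'a). of_rat q * x) (UNIV :: 'a set)"

definition ring_of_integers :: "'a::number_field set" where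
  "ring_of_integers = {x. algebraic_int x}"

text \<open>
  The embeddings \<open>\<sigma>\<^sub>0, \<dots>, \<sigma>\<^sub>d\<^sub>-\<^sub>1\<close> of the field into the complex numbers, in an arbitrary
  but fixed order.  The discriminant, being the square of a determinant, does not depend on it.
\<close>

definition embeddings :: "('a::number_field \<Rightarrow> complex) set" where
  "embeddings = {\<sigma>. field_hom \<sigma>}"

definition nth_embedding :: "nat \<Rightarrow> 'a::number_field \<Rightarrow> complex" where
  "nth_embedding = (SOME \<sigma>. bij_betw \<sigma> {..<nf_degree TYPE('a)} embeddings)"

text \<open>Meaningful for lists of length \<open>nf_degree TYPE('a)\<close>.\<close>

definition disc :: "'a::number_field list \<Rightarrow> complex" where
  "disc \<gamma> = (let d = nf_degree TYPE('a)
             in (det (mat d d (\<lambda>(j, k). nth_embedding j (\<gamma> ! k))))\<^sup>2)"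

definition integral_basis :: "'a::number_field list \<Rightarrow> bool" where
  "integral_basis \<omega> \<longleftrightarrow>
     length \<omega> = nf_degree TYPE('a) \<and> set \<omega> \<subseteq> ring_of_integers \<and>
     (\<forall>x\<in>ring_of_integers. \<exists>!c :: int list.
        length c = length \<omega> \<and> x = (\<Sum>i<length \<omega>. of_int (c ! i) * \<omega> ! i))"

text \<open>The value does not depend on the chosen integral basis.\<close>

definition field_disc :: "'a::number_field itself \<Rightarrow> complex" where
  "field_disc _ = disc (SOME \<omega> :: 'a list. integral_basis \<omega>)"


section \<open>Places and local degrees\<close>

definition absolute_value :: "('a::field \<Rightarrow> real) \<Rightarrow> bool" where
  "absolute_value w \<longleftrightarrow>
     (\<forall>x. w x \<ge> 0) \<and> (\<forall>x. w x = 0 \<longleftrightarrow> x = 0) \<and>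
     (\<forall>x y. w (x * y) = w x * w y) \<and> (\<forall>x y. w (x + y) \<le> w x + w y)"

definition padic_abs :: "nat \<Rightarrow> rat \<Rightarrow> real" where
  "padic_abs p q = (if q = 0 then 0
     else real p powi (int (multiplicity (int p) (snd (quotient_of q)))
                     - int (multiplicity (int p) (fst (quotient_of q)))))"

text \<open>
  Every place, that is, every equivalence class of nontrivial absolute values, contains exactly
  one absolute value extending the usual real or a \<open>p\<close>-adic absolute value of the rationals.
  The place is represented by it.
\<close>

definition places :: "('a::number_field \<Rightarrow> real) set" where
  "places = {w. absolute_value w \<and>
     ((\<forall>q. w (of_rat q) = \<bar>of_rat q\<bar>) \<or>
      (\<exists>p. prime p \<and> (\<forall>q. w (of_rat q) = padic_abs p q)))}"

text \<open>
  The completion at \<open>w\<close> is the ring of Cauchy sequences modulo the ideal of null sequences.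
  The completion of the rationals is identified with its image there: the classes of
  the rational Cauchy sequences.
\<close>

definition cauchy_ring :: "('a::number_field \<Rightarrow> real) \<Rightarrow> (nat \<Rightarrow> 'a) ring" where
  "cauchy_ring w =
     \<lparr>carrier = {s. \<forall>e>0. \<exists>N. \<forall>m\<ge>N. \<forall>n\<ge>N. w (s m - s n) < e},
      monoid.mult = (\<lambda>s t i. s i * t i), one = (\<lambda>_. 1),
      zero = (\<lambda>_. 0), add = (\<lambda>s t i. s i + t i)\<rparr>"

definition null_seqs :: "('a::number_field \<Rightarrow> real) \<Rightarrow> (nat \<Rightarrow> 'a) set" where
  "null_seqs w = {s. (\<lambda>i. w (s i)) \<longlonglongrightarrow> 0}"

definition completion :: "('a::number_field \<Rightarrow> real) \<Rightarrow> (nat \<Rightarrow> 'a) set ring" where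
  "completion w = cauchy_ring w Quot null_seqs w"

definition rat_completion :: "('a::number_field \<Rightarrow> real) \<Rightarrow> (nat \<Rightarrow> 'a) set set" where
  "rat_completion w =
     {null_seqs w +>\<^bsub>cauchy_ring w\<^esub> s | s. s \<in> carrier (cauchy_ring w) \<and> range s \<subseteq> \<rat>}"

definition local_degree :: "('a::number_field \<Rightarrow> real) \<Rightarrow> nat" where
  "local_degree w = ring.dim (completion w) (rat_completion w) (carrier (completion w))"


section \<open>Heights\<close>

definition local_height :: "'a::number_field list \<Rightarrow> ('a \<Rightarrow> real) \<Rightarrow> real" where
  "local_height \<gamma> w = Max (insert 1 ((\<lambda>x. w x ^ local_degree w) ` set \<gamma>))"

text \<open>
  Only finitely many factors differ from 1; restricting to them avoids the convention that
  \<open>prod\<close> over an infinite set is 1.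
\<close>

definition height :: "'a::number_field list \<Rightarrow> real" where
  "height \<gamma> = (\<Prod>w\<in>{w\<in>places. local_height \<gamma> w \<noteq> 1}. local_height \<gamma> w)"


section \<open>The quantities D and M\<close>

text \<open>Coordinates are numbered from 0.\<close>

definition index_sets :: "nat \<Rightarrow> nat \<Rightarrow> nat set set" where
  "index_sets m d = {I. I \<subseteq> {..<m} \<and> card I = d}"

definition calD :: "'a::number_field list \<Rightarrow> real" where
  "calD \<alpha> = 1 / cmod (field_disc TYPE('a)) *
     (\<Sum>I\<in>index_sets (length \<alpha>) (nf_degree TYPE('a)). cmod (disc (nths \<alpha> I)))"

definition calM :: "'a::number_field list \<Rightarrow> 'a \<Rightarrow> real" where
  "calM \<alpha> \<beta> = 1 / sqrt (cmod (field_disc TYPE('a))) *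
     Max ((\<lambda>I. sqrt (cmod (disc (nths (\<alpha> @ [\<beta>]) I))))
            ` index_sets (length \<alpha> + 1) (nf_degree TYPE('a)))"

end

theory Submission
  imports Defs "HOL-Computational_Algebra.Field_as_Ring" "Jordan_Normal_Form.Char_Poly"
begin

text \<open>
  Let \<open>b\<close> be a basis of \<open>K\<close> over the rationals and \<open>S = (\<sigma>\<^sub>j(b\<^sub>k))\<close>.  The algebraic parts of the
  theorem rest on the fact that there are exactly \<open>d\<close> embeddings and that \<open>S\<close> is invertible.  Both
  come out of one statement, \<open>functional_eq_embedding_combination\<close>: every rational-linear map
  \<open>\<phi> : K \<rightarrow> \<complex>\<close> is a complex combination of embeddings.  Indeed \<open>K\<close> acts on such maps by
  \<open>(x\<phi>)(y) = \<phi>(xy)\<close>.  Each \<open>x\<close> is annihilated by a separable polynomial, so its action is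
  diagonalizable; the actions commute, so \<open>\<phi>\<close> is a sum of simultaneous eigenvectors.  For such an
  eigenvector, \<open>\<phi>(xy) = \<chi>(x)\<phi>(y)\<close>, and \<open>\<phi> = \<phi>(1)\<chi>\<close> with \<open>\<chi>\<close> an embedding.  Applied to the coordinate
  functionals of \<open>b\<close>, this gives at least \<open>d\<close> embeddings and a left inverse of \<open>S\<close>; Dedekind's
  independence of characters gives at most \<open>d\<close> of them.

  If \<open>\<gamma> = bM\<close> with a rational matrix \<open>M\<close>, then \<open>disc \<gamma> = (det M)\<^sup>2 disc b\<close>.  Hence \<open>disc \<gamma>\<close> is nonzero exactly
  if \<open>\<gamma>\<close> spans \<open>K\<close>, and a family spans \<open>K\<close> exactly if some \<open>d\<close> of its members do: this is the
  vanishing criterion.  For integrality let \<open>b\<close> be an integral basis.  Integral \<open>\<gamma>\<close> then give an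
  integer matrix \<open>M\<close>, so \<open>disc \<gamma> / \<Delta>\<^sub>K\<close> is the square of an integer.  Sums of such squares, and the
  maximum of their roots, are natural numbers, and these are either 0 or at least 1.
  An integral basis exists because the discriminants of bases of algebraic integers are nonzero
  rational integers, and one of least absolute value belongs to an integral basis
  (\<open>integral_basis_exists\<close>).

  For the height bounds, the Leibniz formula gives
  \<open>\<bar>det (\<sigma>\<^sub>j(\<gamma>\<^sub>k))\<bar> \<le> d! \<Prod>\<^sub>j max(1, \<bar>\<sigma>\<^sub>j(\<gamma>\<^sub>1)\<bar>, \<bar>\<sigma>\<^sub>j(\<gamma>\<^sub>2)\<bar>, \<dots>)\<close>, and the product over the embeddings is at most
  \<open>H\<^sub>K(\<gamma>)\<close> (\<open>prod_embedding_max_le_height\<close>).  To see this, group the embeddings by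
  the place they induce: \<open>\<sigma>\<close> and \<open>\<tau>\<close> induce the same place only if \<open>\<tau>\<close> is \<open>\<sigma>\<close> or its complex conjugate,
  and the completion at that place is the field of real or of complex numbers, so its local degree
  (1 or 2) is at least the number of these embeddings.  All remaining local
  factors are at least 1.  The height is a product over those places where some coordinate exceeds 1;
  that these are finitely many (\<open>finite_places_gt_1\<close>) is shown by an integrality argument,
  which leaves finitely many primes, and by weak approximation, which bounds the number of
  extensions of one absolute value to \<open>K\<close> by \<open>d\<close>.
\<close>

section \<open>Rational bases and coordinates\<close>

interpretation rat_vs: vector_space "\<lambda>(q::rat) (x::'a::field_char_0). of_rat q * x"
  by standard (auto simp: algebra_simps of_rat_add of_rat_mult)

definition rat_basis :: "'a::number_field list \<Rightarrow> bool" where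
  "rat_basis b \<longleftrightarrow> distinct b \<and> rat_vs.independent (set b) \<and> rat_span (set b) = UNIV"

lemma finite_spanning_set:
  "\<exists>B::'a::number_field set. finite B \<and> rat_span B = UNIV"
proof -
  obtain B :: "'a set" where B: "finite B" "\<forall>x. \<exists>c. x = (\<Sum>b\<in>B. of_rat (c b) * b)"
    using finite_degree by blast
  have "x \<in> rat_span B" for x
  proof -
    obtain c where "x = (\<Sum>b\<in>B. of_rat (c b) * b)" using B by blast
    then show ?thesis using rat_vs.span_base
      by (auto intro!: rat_vs.span_sum rat_vs.span_scale)
  qed
  with B show ?thesis by blast
qed

lemma rat_independent_finite:
  fixes B :: "'a::number_field set"
  assumes "rat_vs.independent B"
  shows "finite B" "card B \<le> nf_degree TYPE('a)"
proof -
  obtain S :: "'a set" where S: "finite S" "rat_span S = UNIV" using finite_spanning_set by blast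
  show f: "finite B" using rat_vs.independent_span_bound[OF S(1) assms] S(2) by simp
  obtain C where C: "B \<subseteq> C" "rat_vs.independent C" "rat_span C = UNIV"
    using rat_vs.maximal_independent_subset_extend[OF subset_UNIV assms] by (metis top.extremum_uniqueI)
  then have "finite C" using rat_vs.independent_span_bound[OF S(1)] S(2) by simp
  moreover have "card C = nf_degree TYPE('a)"
    unfolding nf_degree_def using C by (metis rat_vs.dim_eq_card rat_vs.span_UNIV)
  ultimately show "card B \<le> nf_degree TYPE('a)" using C(1) card_mono by metis
qed

lemma length_rat_basis:
  fixes b :: "'a::number_field list"
  assumes "rat_basis b"
  shows "length b = nf_degree TYPE('a)"
  using assms unfolding rat_basis_def nf_degree_def
  by (metis rat_vs.dim_eq_card rat_vs.span_UNIV distinct_card)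

lemma rat_basis_exists_within:
  fixes S :: "'a::number_field set"
  assumes "rat_span S = UNIV"
  obtains b where "rat_basis b" "set b \<subseteq> S"
proof -
  obtain B where B: "B \<subseteq> S" "rat_vs.independent B" "S \<subseteq> rat_span B"
    using rat_vs.maximal_independent_subset by blast
  then have "rat_span B = UNIV" using assms
    by (metis rat_vs.span_minimal rat_vs.subspace_span top.extremum_uniqueI)
  moreover obtain b where "distinct b" "set b = B"
    using finite_distinct_list[OF rat_independent_finite(1)[OF B(2)]] by blast
  ultimately show ?thesis using B that[of b] by (auto simp: rat_basis_def)
qed

definition coord :: "'a::number_field list \<Rightarrow> nat \<Rightarrow> 'a \<Rightarrow> rat" where
  "coord b i x = rat_vs.representation (set b) x (b ! i)"

context
  fixes b :: "'a::number_field list"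
  assumes b: "rat_basis b"
begin

lemma basis_expansion: "x = (\<Sum>i<length b. of_rat (coord b i x) * b ! i)"
proof -
  have d: "distinct b" and i: "rat_vs.independent (set b)" and s: "x \<in> rat_span (set b)"
    using b by (auto simp: rat_basis_def)
  have "x = (\<Sum>v\<in>set b. of_rat (rat_vs.representation (set b) x v) * v)"
    using rat_vs.sum_representation_eq[OF i s _ order_refl] by simp
  also have "\<dots> = (\<Sum>i<length b. of_rat (coord b i x) * b ! i)"
    unfolding coord_def
    by (rule sum.reindex_bij_betw[symmetric, OF bij_betw_nth[OF d refl refl]])
  finally show ?thesis .
qed

lemma coord_add: "coord b i (x + y) = coord b i x + coord b i y"
  using b by (simp add: coord_def rat_basis_def rat_vs.representation_add)

lemma coord_scale: "coord b i (of_rat q * x) = q * coord b i x"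
  using b by (simp add: coord_def rat_basis_def rat_vs.representation_scale)

lemma coord_basis:
  assumes "i < length b" "j < length b"
  shows "coord b i (b ! j) = (if i = j then 1 else 0)"
  using b assms nth_eq_iff_index_eq[of b i j]
  by (auto simp: coord_def rat_basis_def rat_vs.representation_basis)

end

section \<open>Embeddings span the linear functionals\<close>

definition rat_linear :: "('a::field_char_0 \<Rightarrow> complex) \<Rightarrow> bool" where
  "rat_linear \<phi> \<longleftrightarrow> (\<forall>x y. \<phi> (x + y) = \<phi> x + \<phi> y) \<and> (\<forall>q x. \<phi> (of_rat q * x) = of_rat q * \<phi> x)"

lemma rat_linear_sum:
  assumes "rat_linear \<phi>"
  shows "\<phi> (sum f A) = (\<Sum>a\<in>A. \<phi> (f a))"
proof -
  have "\<phi> 0 = 0" using assms unfolding rat_linear_def by (metis add_cancel_right_right)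
  then show ?thesis
    using assms by (induction A rule: infinite_finite_induct) (auto simp: rat_linear_def)
qed

lemma embedding_rules:
  assumes "\<sigma> \<in> embeddings"
  shows "\<sigma> (x + y) = \<sigma> x + \<sigma> y" "\<sigma> (x * y) = \<sigma> x * \<sigma> y" "\<sigma> 1 = 1" "\<sigma> 0 = 0"
    "\<sigma> (x - y) = \<sigma> x - \<sigma> y" "\<sigma> (- x) = - \<sigma> x" "\<sigma> (x ^ n) = \<sigma> x ^ n" "\<sigma> (of_int k) = of_int k"
    "\<sigma> (of_rat q) = of_rat q" "\<sigma> x = 0 \<longleftrightarrow> x = 0"
proof -
  interpret field_hom \<sigma> using assms by (simp add: embeddings_def)
  show "\<sigma> (x + y) = \<sigma> x + \<sigma> y" "\<sigma> (x * y) = \<sigma> x * \<sigma> y" "\<sigma> 1 = 1" "\<sigma> 0 = 0"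
    "\<sigma> (x - y) = \<sigma> x - \<sigma> y" "\<sigma> (- x) = - \<sigma> x" "\<sigma> (x ^ n) = \<sigma> x ^ n" "\<sigma> (of_int k) = of_int k"
    "\<sigma> x = 0 \<longleftrightarrow> x = 0"
    by (simp_all only: hom_add hom_mult hom_one hom_zero hom_minus hom_uminus hom_power hom_of_int hom_0_iff)
  obtain m n where mn: "quotient_of q = (m, n)" by fastforce
  then have q: "q = of_int m / of_int n" "n > 0"
    using quotient_of_div quotient_of_denom_pos by auto
  have "(of_rat q :: 'a) * of_int n = of_int m" "(of_rat q :: complex) * of_int n = of_int m"
    using q by (auto simp: of_rat_divide)
  from arg_cong[OF this(1), of \<sigma>] this(2) have "\<sigma> (of_rat q) * of_int n = of_rat q * of_int n"
    by (simp only: hom_mult hom_of_int)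
  then show "\<sigma> (of_rat q) = of_rat q" using q by simp
qed

lemma embedding_rat_linear: "\<sigma> \<in> embeddings \<Longrightarrow> rat_linear \<sigma>"
  by (simp add: rat_linear_def embedding_rules)


text \<open>
  Dedekind's argument: from a relation among characters, the relation multiplied by \<open>\<rho>(z)\<close> is
  subtracted from the relation evaluated at \<open>zy\<close>.  This eliminates \<open>\<rho>\<close> and multiplies every other
  coefficient by \<open>\<sigma>(z) - \<rho>(z)\<close>, which is nonzero for a suitable \<open>z\<close>.
\<close>

lemma dedekind_independence:
  assumes "finite S" "S \<subseteq> embeddings" "\<And>y. (\<Sum>\<sigma>\<in>S. a \<sigma> * \<sigma> y) = 0" "\<tau> \<in> S"
  shows "a \<tau> = 0"
  using assms
proof (induction S arbitrary: a \<tau> rule: finite_induct)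
  case (insert \<rho> S)
  have zero: "a \<sigma> = 0" if s: "\<sigma> \<in> S" for \<sigma>
  proof -
    have ne: "\<sigma> \<noteq> \<rho>" using s insert.hyps by auto
    then obtain z where z: "\<sigma> z \<noteq> \<rho> z" by auto
    have "(\<Sum>\<sigma>\<in>S. a \<sigma> * (\<sigma> z - \<rho> z) * \<sigma> y) = 0" for y
    proof -
      have "0 = (\<Sum>\<sigma>\<in>insert \<rho> S. a \<sigma> * \<sigma> (z * y)) - \<rho> z * (\<Sum>\<sigma>\<in>insert \<rho> S. a \<sigma> * \<sigma> y)"
        using insert.prems(2) by simp
      also have "\<dots> = (\<Sum>\<sigma>\<in>insert \<rho> S. a \<sigma> * (\<sigma> z - \<rho> z) * \<sigma> y)"
        unfolding sum_distrib_left sum_subtractf[symmetric]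
        using insert.prems(1) by (intro sum.cong) (auto simp: embedding_rules algebra_simps subset_iff)
      finally show ?thesis using insert.hyps by simp
    qed
    from insert.IH[OF _ this s] insert.prems(1) z show ?thesis by simp
  qed
  then have "a \<rho> * \<rho> 1 = 0" using insert.prems(2)[of 1] insert.hyps by simp
  then have "a \<rho> = 0" using insert.prems(1) embedding_rules(3)[of \<rho>] by auto
  with zero insert.prems(3) show ?case by auto
qed simp

text \<open>
  Padding the \<open>m\<close> equations with zero rows gives a square matrix whose determinant vanishes.
\<close>

lemma homogeneous_system_nontrivial:
  fixes f :: "nat \<Rightarrow> nat \<Rightarrow> 'b::field"
  assumes "m < n"
  shows "\<exists>a. (\<exists>j<n. a j \<noteq> 0) \<and> (\<forall>i<m. (\<Sum>j<n. f i j * a j) = 0)"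
proof -
  define A where "A = mat n n (\<lambda>(i, j). if i < m then f i j else 0)"
  have A: "A \<in> carrier_mat n n" by (simp add: A_def)
  have "det A = 0"
    using laplace_expansion_row[OF A assms] assms by (simp add: A_def)
  then obtain v where v: "v \<in> carrier_vec n" "v \<noteq> 0\<^sub>v n" "A *\<^sub>v v = 0\<^sub>v n"
    using det_0_iff_vec_prod_zero_field[OF A] by blast
  have "\<exists>j<n. v $ j \<noteq> 0" using v by (metis eq_vecI carrier_vecD index_zero_vec)
  moreover have "(\<Sum>j<n. f i j * v $ j) = 0" if "i < m" for i
  proof -
    have "(A *\<^sub>v v) $ i = (\<Sum>j<n. f i j * v $ j)"
      using that assms v(1) by (simp add: A_def scalar_prod_def atLeast0LessThan)
    then show ?thesis using v(3) that assms by simp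
  qed
  ultimately show ?thesis by (intro exI[of _ "\<lambda>j. v $ j"]) blast
qed


text \<open>
  More than \<open>d\<close> embeddings would be dependent as vectors of their values on a basis, hence, by
  linearity, dependent as functions.
\<close>

lemma finite_embeddings_card_le:
  assumes "S \<subseteq> (embeddings :: ('a::number_field \<Rightarrow> complex) set)" "finite S"
  shows "card S \<le> nf_degree TYPE('a)"
proof (rule ccontr)
  assume less: "\<not> ?thesis"
  obtain b :: "'a list" where b: "rat_basis b"
    using rat_basis_exists_within[of UNIV] by (metis rat_vs.span_UNIV)
  have len: "length b < card S" using less length_rat_basis[OF b] by simp
  obtain s where s: "bij_betw s {..<card S} S"
    using ex_bij_betw_nat_finite[OF assms(2)] by (auto simp: atLeast0LessThan)
  obtain a where a: "\<exists>j<card S. a j \<noteq> 0" "\<And>i. i < length b \<Longrightarrow> (\<Sum>j<card S. s j (b ! i) * a j) = 0"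
    using homogeneous_system_nontrivial[OF len, of "\<lambda>i j. s j (b ! i)"] by blast
  define a' where "a' \<sigma> = a (inv_into {..<card S} s \<sigma>)" for \<sigma>
  have a'[simp]: "a' (s j) = a j" if "j < card S" for j
    using that s by (simp add: a'_def bij_betw_def inv_into_f_f)
  have lin: "s j y = (\<Sum>i<length b. of_rat (coord b i y) * s j (b ! i))" if "j < card S" for j y
  proof -
    have "s j \<in> embeddings" using that s assms(1) by (auto simp: bij_betw_def)
    from embedding_rat_linear[OF this] show ?thesis
      by (subst basis_expansion[OF b, of y]) (simp add: rat_linear_sum, simp add: rat_linear_def)
  qed
  have "(\<Sum>\<sigma>\<in>S. a' \<sigma> * \<sigma> y) = 0" for y
  proof -
    have "(\<Sum>\<sigma>\<in>S. a' \<sigma> * \<sigma> y) = (\<Sum>j<card S. a' (s j) * s j y)"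
      by (rule sum.reindex_bij_betw[OF s, symmetric])
    also have "\<dots> = (\<Sum>j<card S. \<Sum>i<length b. of_rat (coord b i y) * (s j (b ! i) * a j))"
      by (intro sum.cong refl, subst lin) (auto simp: sum_distrib_left mult_ac)
    also have "\<dots> = (\<Sum>i<length b. of_rat (coord b i y) * (\<Sum>j<card S. s j (b ! i) * a j))"
      by (subst sum.swap) (simp add: sum_distrib_left)
    also have "\<dots> = 0" using a(2) by simp
    finally show ?thesis .
  qed
  from dedekind_independence[OF assms(2,1) this] have "\<And>\<tau>. \<tau> \<in> S \<Longrightarrow> a' \<tau> = 0" .
  then have "a j = 0" if "j < card S" for j
    using that a'[OF that] s by (metis bij_betwE lessThan_iff)
  with a(1) show False by blast
qed

lemma finite_embeddings: "finite (embeddings :: ('a::number_field \<Rightarrow> complex) set)"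
proof (rule ccontr)
  assume "infinite (embeddings :: ('a \<Rightarrow> complex) set)"
  then obtain S :: "('a \<Rightarrow> complex) set" where "finite S" "card S = Suc (nf_degree TYPE('a))" "S \<subseteq> embeddings"
    using infinite_arbitrarily_large by blast
  then show False using finite_embeddings_card_le[of S] by simp
qed

text \<open>
  A rational polynomial of least degree that annihilates \<open>x\<close> is coprime to its derivative: by minimality
  a common divisor of smaller degree does not vanish at \<open>x\<close>, so that its cofactor does, and the cofactor
  has full degree only if the divisor is constant.  A Bezout relation over the rationals then
  excludes multiple complex roots.
\<close>

lemma separable_annihilator:
  fixes x :: "'a::number_field"
  obtains f :: "rat poly" where "poly (map_poly of_rat f) x = 0"
    "rsquarefree (map_poly of_rat f :: complex poly)"
proof -
  interpret a: comm_ring_hom "of_rat :: rat \<Rightarrow> 'a" ..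
  interpret a: map_poly_comm_ring_hom "of_rat :: rat \<Rightarrow> 'a" ..
  interpret c: comm_ring_hom "of_rat :: rat \<Rightarrow> complex" ..
  interpret c: map_poly_comm_ring_hom "of_rat :: rat \<Rightarrow> complex" ..
  let ?ev = "\<lambda>f. poly (map_poly of_rat f) x"
  have ev_pderiv: "pderiv (map_poly of_rat f :: complex poly) = map_poly of_rat (pderiv f)" for f
    by (intro poly_eqI) (simp add: coeff_pderiv coeff_map_poly of_rat_mult of_rat_add)
  have "\<exists>f::rat poly. f \<noteq> 0 \<and> ?ev f = 0"
  proof -
    obtain b :: "'a list" where b: "rat_basis b"
      using rat_basis_exists_within[of UNIV] by (metis rat_vs.span_UNIV)
    obtain a where a: "\<exists>j<Suc (length b). a j \<noteq> 0"
      "\<And>i. i < length b \<Longrightarrow> (\<Sum>j<Suc (length b). coord b i (x ^ j) * a j) = 0"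
      using homogeneous_system_nontrivial[of "length b" "Suc (length b)" "\<lambda>i j. coord b i (x ^ j)"]
      by blast
    define f where "f = (\<Sum>j<Suc (length b). monom (a j) j)"
    have cf: "coeff f j = (if j < Suc (length b) then a j else 0)" for j
      unfolding f_def coeff_sum by (auto simp: if_distrib sum.delta cong: if_cong)
    have "f \<noteq> 0" using a(1) cf by (metis coeff_0)
    moreover have "?ev f = (\<Sum>j<Suc (length b). of_rat (a j) * x ^ j)"
    proof -
      have "map_poly of_rat f = (\<Sum>j<Suc (length b). monom (of_rat (a j)) j :: 'a poly)"
        by (intro poly_eqI) (auto simp: coeff_sum coeff_map_poly cf)
      then show ?thesis by (simp only: poly_sum poly_monom)
    qed
    moreover have "\<dots> = (\<Sum>j<Suc (length b). \<Sum>i<length b. of_rat (coord b i (x ^ j) * a j) * b ! i)"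
      by (intro sum.cong refl, subst basis_expansion[OF b])
        (simp add: sum_distrib_left of_rat_mult mult_ac)
    moreover have "\<dots> = (\<Sum>i<length b. of_rat (\<Sum>j<Suc (length b). coord b i (x ^ j) * a j) * b ! i)"
      by (subst sum.swap) (simp only: of_rat_sum sum_distrib_right)
    ultimately show ?thesis using a(2) by (intro exI[of _ f]) auto
  qed
  then have "\<exists>f. (f \<noteq> 0 \<and> ?ev f = 0) \<and> (\<forall>g. (g \<noteq> 0 \<and> ?ev g = 0) \<longrightarrow> degree f \<le> degree g)"
    using ex_has_least_nat[of "\<lambda>f. f \<noteq> 0 \<and> ?ev f = 0" _ degree] by blast
  then obtain f where f: "f \<noteq> 0" "?ev f = 0"
    and min: "\<And>g. g \<noteq> 0 \<Longrightarrow> ?ev g = 0 \<Longrightarrow> degree f \<le> degree g" by blast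
  have "degree f \<noteq> 0"
  proof
    assume "degree f = 0"
    then obtain a where "f = [:a:]" by (rule degree_eq_zeroE)
    then show False using f by (simp add: map_poly_pCons)
  qed
  have "Rings.coprime f (pderiv f)"
  proof (rule coprimeI)
    fix g assume g: "g dvd f" "g dvd pderiv f"
    then obtain h where h: "f = g * h" by (auto elim: dvdE)
    have "pderiv f \<noteq> 0" using \<open>degree f \<noteq> 0\<close> by (simp add: pderiv_eq_0_iff)
    then have "degree g \<le> degree (pderiv f)" using g(2) by (intro dvd_imp_degree_le)
    then have "degree g < degree f" using \<open>degree f \<noteq> 0\<close> by (simp add: degree_pderiv)
    have g0: "g \<noteq> 0" "h \<noteq> 0" using h f by auto
    then have "?ev g \<noteq> 0" using min[of g] \<open>degree g < degree f\<close> by auto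
    then have "?ev h = 0" using f(2) unfolding h a.hom_mult by simp
    then have "degree f \<le> degree h" using min g0 by blast
    then have "degree g = 0" using h g0 by (simp add: degree_mult_eq)
    then show "is_unit g" using g0 by (simp add: is_unit_iff_degree)
  qed
  then obtain u v where "u * f + v * pderiv f = 1"
    using bezout_coefficients_fst_snd by (metis coprime_iff_gcd_eq_1)
  then have "map_poly of_rat u * map_poly of_rat f + map_poly of_rat v * map_poly of_rat (pderiv f)
      = (1 :: complex poly)"
    by (metis c.hom_add c.hom_mult c.hom_one)
  then have "poly (map_poly of_rat u * map_poly of_rat f
      + map_poly of_rat v * map_poly of_rat (pderiv f)) z = (1 :: complex)" for z
    by simp
  then have "\<not> (poly (map_poly of_rat f :: complex poly) z = 0
      \<and> poly (pderiv (map_poly of_rat f)) z = 0)" for z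
    unfolding ev_pderiv poly_add poly_mult by (metis add_0 mult_zero_right zero_neq_one)
  then show ?thesis using that[of f] f(2) unfolding rsquarefree_roots by blast
qed


text \<open>
  The action of \<open>p(x)\<close> on functions on \<open>K\<close>, where \<open>x\<close> acts by \<open>(x\<phi>)(y) = \<phi>(xy)\<close>.  The polynomial has complex
  coefficients, so this is the action of an element of \<open>\<complex> \<otimes> K\<close>.
\<close>

definition poly_act :: "'a::number_field \<Rightarrow> complex poly \<Rightarrow> ('a \<Rightarrow> complex) \<Rightarrow> 'a \<Rightarrow> complex" where
  "poly_act x p \<phi> y = (\<Sum>i\<le>degree p. poly.coeff p i * \<phi> (x ^ i * y))"

lemma poly_act_eq_sum_upto:
  assumes "degree p \<le> N"
  shows "poly_act x p \<phi> y = (\<Sum>i\<le>N. poly.coeff p i * \<phi> (x ^ i * y))"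
  unfolding poly_act_def using assms
  by (intro sum.mono_neutral_left finite_atMost ballI) (simp_all add: coeff_eq_0)

lemma poly_act_linear_factor:
  "poly_act x ([:-l, 1:] * q) \<phi> y = poly_act x q (\<lambda>y. \<phi> (x * y) - l * \<phi> y) y"
proof -
  let ?N = "degree q"
  have d: "degree ([:-l, 1:] * q) \<le> Suc ?N"
    by (rule order_trans[OF degree_mult_le]) simp
  have c: "poly.coeff ([:-l, 1:] * q) i = (case i of 0 \<Rightarrow> 0 | Suc j \<Rightarrow> poly.coeff q j) - l * poly.coeff q i" for i
    by (auto simp: coeff_pCons split: nat.splits)
  have "poly_act x ([:-l, 1:] * q) \<phi> y
      = (\<Sum>i\<le>Suc ?N. (case i of 0 \<Rightarrow> 0 | Suc j \<Rightarrow> poly.coeff q j) * \<phi> (x ^ i * y))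
        - l * (\<Sum>i\<le>Suc ?N. poly.coeff q i * \<phi> (x ^ i * y))"
    unfolding poly_act_eq_sum_upto[OF d] c sum_distrib_left sum_subtractf[symmetric]
    by (intro sum.cong refl) (simp add: algebra_simps)
  also have "(\<Sum>i\<le>Suc ?N. (case i of 0 \<Rightarrow> 0 | Suc j \<Rightarrow> poly.coeff q j) * \<phi> (x ^ i * y))
      = (\<Sum>i\<le>?N. poly.coeff q i * \<phi> (x ^ i * (x * y)))"
    unfolding sum.atMost_Suc_shift by (simp add: mult_ac)
  also have "(\<Sum>i\<le>Suc ?N. poly.coeff q i * \<phi> (x ^ i * y)) = (\<Sum>i\<le>?N. poly.coeff q i * \<phi> (x ^ i * y))"
    by (simp add: coeff_eq_0)
  finally show ?thesis
    unfolding poly_act_def sum_distrib_left sum_subtractf[symmetric]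
    by (simp add: algebra_simps)
qed

text \<open>
  If distinct linear factors \<open>x - z\<close> together annihilate \<open>\<phi>\<close>, then \<open>\<phi>\<close> is a sum of eigenvectors of \<open>x\<close>.
  The predicate \<open>P\<close> describes a subspace that is stable under \<open>x\<close>: the eigenvectors stay in it, so eigenvector
  properties for other elements of \<open>K\<close> are not lost when this is applied to one element after the other.
\<close>

lemma eigenvector_decomposition:
  fixes P :: "('a::number_field \<Rightarrow> complex) \<Rightarrow> bool"
  assumes add: "\<And>\<phi> \<psi>. P \<phi> \<Longrightarrow> P \<psi> \<Longrightarrow> P (\<lambda>y. \<phi> y + \<psi> y)"
    and scale: "\<And>c \<phi>. P \<phi> \<Longrightarrow> P (\<lambda>y. c * \<phi> y)"
    and shift: "\<And>\<phi>. P \<phi> \<Longrightarrow> P (\<lambda>y. \<phi> (x * y))"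
    and "finite \<Lambda>" "P \<phi>" "\<And>y. poly_act x (\<Prod>z\<in>\<Lambda>. [:-z, 1:]) \<phi> y = 0"
  shows "\<exists>F. (\<forall>z\<in>\<Lambda>. P (F z) \<and> (\<forall>y. F z (x * y) = z * F z y)) \<and> (\<forall>y. \<phi> y = (\<Sum>z\<in>\<Lambda>. F z y))"
  using assms(4-6)
proof (induction \<Lambda> arbitrary: \<phi> rule: finite_induct)
  case empty
  then show ?case by (simp add: poly_act_def)
next
  case (insert l \<Lambda>)
  \<comment> \<open>\<open>\<psi> = (x - l)\<phi>\<close> is annihilated by the other factors, so it is a sum of eigenvectors \<open>G z\<close>.\<close>
  define \<psi> where "\<psi> = (\<lambda>y. \<phi> (x * y) - l * \<phi> y)"
  have sum_P: "P (\<lambda>y. \<Sum>z\<in>A. f z y)" if "finite A" "\<And>z. z \<in> A \<Longrightarrow> P (f z)" for A and f :: "complex \<Rightarrow> 'a \<Rightarrow> complex"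
    using that
  proof (induction A rule: finite_induct)
    case empty
    then show ?case using scale[OF insert.prems(1), where c = 0] by simp
  next
    case (insert z A)
    then show ?case using add[of "f z" "\<lambda>y. \<Sum>z\<in>A. f z y"] by simp
  qed
  have "P \<psi>"
    using add[OF shift[OF insert.prems(1)] scale[OF insert.prems(1), where c = "-l"]] by (simp add: \<psi>_def)
  moreover have "poly_act x (\<Prod>z\<in>\<Lambda>. [:-z, 1:]) \<psi> y = 0" for y
    using insert.prems(2)[of y] insert.hyps
    by (simp only: prod.insert poly_act_linear_factor \<psi>_def not_False_eq_True)
  ultimately obtain G where G: "\<And>z. z \<in> \<Lambda> \<Longrightarrow> P (G z)" "\<And>z y. z \<in> \<Lambda> \<Longrightarrow> G z (x * y) = z * G z y"
    "\<And>y. \<psi> y = (\<Sum>z\<in>\<Lambda>. G z y)"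
    using insert.IH[of \<psi>] by blast
  \<comment> \<open>On \<open>G z\<close> the operator \<open>x - l\<close> is multiplication by \<open>z - l\<close>.  So \<open>\<phi> - \<Sum> H z\<close> is killed by \<open>x - l\<close>.\<close>
  define H where "H z = (\<lambda>y. 1 / (z - l) * G z y)" for z
  define F where "F z = (if z = l then (\<lambda>y. \<phi> y + (-1) * (\<Sum>z\<in>\<Lambda>. H z y)) else H z)" for z
  have PH: "P (H z)" if "z \<in> \<Lambda>" for z
    unfolding H_def using G(1)[OF that] by (rule scale)
  have "P (F z)" if "z \<in> insert l \<Lambda>" for z
    using that PH add[OF insert.prems(1) scale[OF sum_P[OF insert.hyps(1) PH], where c = "-1"]]
    by (auto simp: F_def)
  moreover have "F z (x * y) = z * F z y" if "z \<in> insert l \<Lambda>" for z y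
  proof (cases "z = l")
    case True
    have "(\<Sum>z\<in>\<Lambda>. H z (x * y)) - l * (\<Sum>z\<in>\<Lambda>. H z y) = (\<Sum>z\<in>\<Lambda>. G z y)"
      unfolding sum_distrib_left sum_subtractf[symmetric]
    proof (rule sum.cong[OF refl])
      fix z assume z: "z \<in> \<Lambda>"
      then have "z - l \<noteq> 0" using insert.hyps by auto
      have "H z (x * y) - l * H z y = (z - l) * G z y / (z - l)"
        by (simp add: H_def G(2)[OF z, of y] left_diff_distrib diff_divide_distrib)
      with \<open>z - l \<noteq> 0\<close> show "H z (x * y) - l * H z y = G z y" by simp
    qed
    then have "\<phi> (x * y) - l * \<phi> y = (\<Sum>z\<in>\<Lambda>. H z (x * y)) - l * (\<Sum>z\<in>\<Lambda>. H z y)"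
      using G(3)[of y] by (simp add: \<psi>_def)
    then show ?thesis using True by (simp add: F_def algebra_simps)
  next
    case False
    then show ?thesis using that G(2)[of z y] by (simp add: F_def H_def)
  qed
  moreover have "\<phi> y = (\<Sum>z\<in>insert l \<Lambda>. F z y)" for y
  proof -
    have "(\<Sum>z\<in>\<Lambda>. F z y) = (\<Sum>z\<in>\<Lambda>. H z y)"
      using insert.hyps by (intro sum.cong) (auto simp: F_def)
    then show ?thesis using insert.hyps by (simp add: F_def)
  qed
  ultimately show ?case by (intro exI[of _ F]) blast
qed

lemma poly_act_annihilator:
  fixes x :: "'a::number_field"
  assumes "rat_linear \<phi>" "poly (map_poly of_rat f) x = 0"
  shows "poly_act x (map_poly of_rat f) \<phi> y = 0"
proof -
  have "poly_act x (map_poly of_rat f) \<phi> y = (\<Sum>i\<le>degree f. of_rat (poly.coeff f i) * \<phi> (x ^ i * y))"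
    by (subst poly_act_eq_sum_upto[of _ "degree f"]) (auto simp: degree_map_poly coeff_map_poly)
  also have "\<dots> = \<phi> (\<Sum>i\<le>degree f. of_rat (poly.coeff f i) * (x ^ i * y))"
    using assms(1) by (simp add: rat_linear_sum) (simp add: rat_linear_def)
  also have "(\<Sum>i\<le>degree f. of_rat (poly.coeff f i) * (x ^ i * y)) = poly (map_poly of_rat f) x * y"
    by (simp add: poly_altdef degree_map_poly coeff_map_poly sum_distrib_right sum_distrib_left mult_ac)
  also have "\<phi> \<dots> = 0" using rat_linear_sum[OF assms(1), of _ "{}"] assms(2) by simp
  finally show ?thesis .
qed

text \<open>
  The functional is split into eigenvectors of one basis element after the other, by induction on the
  set \<open>T\<close> of those basis elements for which it is not yet known to be an eigenvector.  An eigenvector of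
  all of them is a multiple of an embedding, namely of its own eigenvalue character.
\<close>

lemma functional_eq_embedding_combination:
  fixes \<phi> :: "'a::number_field \<Rightarrow> complex"
  assumes "rat_linear \<phi>"
  obtains c where "\<And>y. \<phi> y = (\<Sum>\<sigma>\<in>embeddings. c \<sigma> * \<sigma> y)"
proof -
  obtain b :: "'a list" where b: "rat_basis b"
    using rat_basis_exists_within[of UNIV] by (metis rat_vs.span_UNIV)
  have "\<exists>c. \<forall>y. \<phi> y = (\<Sum>\<sigma>\<in>embeddings. c \<sigma> * \<sigma> y)"
    if "finite T" "rat_linear \<phi>" "\<And>v y. v \<in> set b - T \<Longrightarrow> \<phi> (v * y) = \<mu> v * \<phi> y" for T \<mu> and \<phi> :: "'a \<Rightarrow> complex"
    using that
  proof (induction T arbitrary: \<phi> \<mu> rule: finite_induct)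
    case empty
    \<comment> \<open>The eigenvalues on the basis extend linearly to a character.\<close>
    define \<chi> where "\<chi> z = (\<Sum>i<length b. of_rat (coord b i z) * \<mu> (b ! i))" for z
    have eigen: "\<phi> (z * y) = \<chi> z * \<phi> y" for z y
    proof -
      have "\<phi> (z * y) = \<phi> (\<Sum>i<length b. of_rat (coord b i z) * (b ! i * y))"
        by (subst basis_expansion[OF b, of z]) (simp add: sum_distrib_right sum_distrib_left mult_ac)
      also have "\<dots> = (\<Sum>i<length b. of_rat (coord b i z) * \<phi> (b ! i * y))"
        using empty.prems(1) by (simp add: rat_linear_sum) (simp add: rat_linear_def)
      also have "\<dots> = (\<Sum>i<length b. of_rat (coord b i z) * (\<mu> (b ! i) * \<phi> y))"
        using empty.prems(2) by (intro sum.cong refl) simp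
      also have "\<dots> = \<chi> z * \<phi> y" by (simp add: \<chi>_def sum_distrib_right sum_distrib_left mult_ac)
      finally show ?thesis .
    qed
    show ?case
    proof (cases "\<phi> 1 = 0")
      case True
      then have "\<phi> y = 0" for y using eigen[of y 1] by simp
      then show ?thesis by (intro exI[of _ "\<lambda>_. 0"]) simp
    next
      case False
      have \<chi>: "\<chi> z = \<phi> z / \<phi> 1" for z using eigen[of z 1] False by simp
      have "\<chi> (z * w) * \<phi> 1 = \<chi> z * \<chi> w * \<phi> 1" for z w
        by (metis eigen mult.assoc mult.right_neutral)
      then have "\<chi> (z * w) = \<chi> z * \<chi> w" for z w using False by simp
      moreover have "\<chi> (z + w) = \<chi> z + \<chi> w" for z w
        unfolding \<chi> using empty.prems(1) by (simp add: rat_linear_def add_divide_distrib)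
      moreover have "\<chi> 1 = 1" using False by (simp add: \<chi>)
      moreover have "\<chi> 0 = 0" using rat_linear_sum[OF empty.prems(1), of _ "{}"] by (simp add: \<chi>)
      ultimately have "\<chi> \<in> embeddings"
        unfolding embeddings_def mem_Collect_eq by unfold_locales auto
      then have "\<phi> y = (\<Sum>\<sigma>\<in>embeddings. (if \<sigma> = \<chi> then \<phi> 1 else 0) * \<sigma> y)" for y
        using False by (simp add: finite_embeddings \<chi> if_distrib[of "\<lambda>t. t * _"] cong: if_cong)
      then show ?thesis by (intro exI[of _ "\<lambda>\<sigma>. if \<sigma> = \<chi> then \<phi> 1 else 0"] allI)
    qed
  next
    case (insert t T)
    obtain f where f: "poly (map_poly of_rat f) t = 0" "rsquarefree (map_poly of_rat f :: complex poly)"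
      by (rule separable_annihilator)
    define p where "p = (map_poly of_rat f :: complex poly)"
    define \<Lambda> where "\<Lambda> = {z. poly p z = 0}"
    have p0: "p \<noteq> 0" using f(2) by (simp add: p_def rsquarefree_def)
    then have fin: "finite \<Lambda>" by (simp add: \<Lambda>_def poly_roots_finite)
    have dec: "smult (lead_coeff p) (\<Prod>z\<in>\<Lambda>. [:-z, 1:]) = p"
      using complex_poly_decompose_rsquarefree[of p] f(2) by (simp add: p_def \<Lambda>_def)
    have poly_act_smult: "poly_act t (smult c q) \<phi> y = c * poly_act t q \<phi> y" for c q y
      using poly_act_eq_sum_upto[of "smult c q" "degree q" t \<phi> y]
      by (simp add: degree_smult_le poly_act_def sum_distrib_left mult.assoc)
    have "lead_coeff p * poly_act t (\<Prod>z\<in>\<Lambda>. [:-z, 1:]) \<phi> y = 0" for y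
      using poly_act_annihilator[OF insert.prems(1) f(1), of y] poly_act_smult dec by (metis p_def)
    then have zero: "poly_act t (\<Prod>z\<in>\<Lambda>. [:-z, 1:]) \<phi> y = 0" for y using p0 by simp
    let ?P = "\<lambda>\<psi>. rat_linear \<psi> \<and> (\<forall>v\<in>set b - insert t T. \<forall>y. \<psi> (v * y) = \<mu> v * \<psi> y)"
    have "?P \<phi>" using insert.prems by blast
    have "\<exists>F. (\<forall>z\<in>\<Lambda>. ?P (F z) \<and> (\<forall>y. F z (t * y) = z * F z y)) \<and> (\<forall>y. \<phi> y = (\<Sum>z\<in>\<Lambda>. F z y))"
      by (rule eigenvector_decomposition[where P = ?P, OF _ _ _ fin \<open>?P \<phi>\<close> zero])
        (auto simp: rat_linear_def algebra_simps, metis mult.commute mult.left_commute)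
    then obtain F where F: "\<And>z. z \<in> \<Lambda> \<Longrightarrow> ?P (F z)" "\<And>z y. z \<in> \<Lambda> \<Longrightarrow> F z (t * y) = z * F z y"
      "\<And>y. \<phi> y = (\<Sum>z\<in>\<Lambda>. F z y)" by blast
    have "\<exists>c. \<forall>y. F z y = (\<Sum>\<sigma>\<in>embeddings. c \<sigma> * \<sigma> y)" if z: "z \<in> \<Lambda>" for z
    proof (rule insert.IH[of "F z" "\<mu>(t := z)"])
      show "rat_linear (F z)" using F(1)[OF z] by blast
      show "F z (v * y) = (\<mu>(t := z)) v * F z y" if "v \<in> set b - T" for v y
        using F(1)[OF z] F(2)[OF z] that by auto
    qed
    then obtain c where c: "\<And>z y. z \<in> \<Lambda> \<Longrightarrow> F z y = (\<Sum>\<sigma>\<in>embeddings. c z \<sigma> * \<sigma> y)" by metis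
    have "\<phi> y = (\<Sum>\<sigma>\<in>embeddings. (\<Sum>z\<in>\<Lambda>. c z \<sigma>) * \<sigma> y)" for y
    proof -
      have "\<phi> y = (\<Sum>z\<in>\<Lambda>. \<Sum>\<sigma>\<in>embeddings. c z \<sigma> * \<sigma> y)" using F(3) c by simp
      then show ?thesis by (subst (asm) sum.swap) (simp add: sum_distrib_right)
    qed
    then show ?case by (intro exI[of _ "\<lambda>\<sigma>. \<Sum>z\<in>\<Lambda>. c z \<sigma>"] allI)
  qed
  from this[of "set b" \<phi>] assms that show ?thesis by auto
qed

text \<open>
  The coordinate functional of \<open>b\<^sub>k\<close> is a combination of embeddings, and it picks out \<open>a\<^sub>k\<close>.
  In matrix terms: \<open>(\<sigma>(b\<^sub>j))\<close> has trivial kernel.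
\<close>

lemma embeddings_separate_combinations:
  fixes b :: "'a::number_field list"
  assumes b: "rat_basis b"
    and "\<And>\<sigma>. \<sigma> \<in> embeddings \<Longrightarrow> (\<Sum>j<length b. \<sigma> (b ! j) * a j) = 0" and "k < length b"
  shows "a k = 0"
proof -
  have "rat_linear (\<lambda>y. of_rat (coord b k y))"
    using b by (simp add: rat_linear_def coord_add coord_scale of_rat_add of_rat_mult)
  then obtain c where c: "\<And>y. of_rat (coord b k y) = (\<Sum>\<sigma>\<in>embeddings. c \<sigma> * \<sigma> y)"
    using functional_eq_embedding_combination by blast
  have "a k = (\<Sum>j<length b. of_rat (coord b k (b ! j)) * a j)"
    using assms(3) b by (simp add: coord_basis if_distrib[of of_rat] if_distrib[of "\<lambda>t. t * _"] cong: if_cong)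
  also have "\<dots> = (\<Sum>\<sigma>\<in>embeddings. c \<sigma> * (\<Sum>j<length b. \<sigma> (b ! j) * a j))"
    unfolding c sum_distrib_right sum_distrib_left by (subst sum.swap) (simp only: mult_ac)
  also have "\<dots> = 0" using assms(2) by simp
  finally show ?thesis .
qed

lemma card_embeddings: "card (embeddings :: ('a::number_field \<Rightarrow> complex) set) = nf_degree TYPE('a)"
proof (rule antisym)
  let ?E = "embeddings :: ('a \<Rightarrow> complex) set"
  show "card ?E \<le> nf_degree TYPE('a)"
    by (rule finite_embeddings_card_le[OF order_refl finite_embeddings])
  show "nf_degree TYPE('a) \<le> card ?E"
  proof (rule ccontr)
    assume "\<not> ?thesis"
    then have less: "card ?E < nf_degree TYPE('a)" by simp
    obtain b :: "'a list" where b: "rat_basis b"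
      using rat_basis_exists_within[of UNIV] by (metis rat_vs.span_UNIV)
    obtain s where s: "bij_betw s {..<card ?E} ?E"
      using ex_bij_betw_nat_finite[OF finite_embeddings] by (auto simp: atLeast0LessThan)
    from homogeneous_system_nontrivial[OF less[folded length_rat_basis[OF b]], of "\<lambda>i j. s i (b ! j)"]
    obtain a k where a: "k < length b" "a k \<noteq> 0"
      "\<And>i. i < card ?E \<Longrightarrow> (\<Sum>j<length b. s i (b ! j) * a j) = 0" by blast
    have "(\<Sum>j<length b. \<sigma> (b ! j) * a j) = 0" if "\<sigma> \<in> ?E" for \<sigma>
    proof -
      have "\<sigma> \<in> s ` {..<card ?E}" using s that by (simp add: bij_betw_def)
      then show ?thesis using a(3) by auto
    qed
    from embeddings_separate_combinations[OF b this a(1)] a(2) show False by simp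
  qed
qed

lemma nth_embedding_bij:
  "bij_betw (nth_embedding :: nat \<Rightarrow> 'a::number_field \<Rightarrow> complex) {..<nf_degree TYPE('a)} embeddings"
proof -
  have "\<exists>s. bij_betw s {..<nf_degree TYPE('a)} (embeddings :: ('a \<Rightarrow> complex) set)"
    using ex_bij_betw_nat_finite[OF finite_embeddings] by (metis atLeast0LessThan card_embeddings)
  then show ?thesis unfolding nth_embedding_def by (rule someI_ex)
qed


section \<open>Algebraic integers\<close>

text \<open>
  If multiplication by \<open>x\<close> maps a nonzero finitely generated subgroup of the field into itself, then \<open>x\<close> is
  an eigenvalue of an integer matrix, hence a root of its characteristic polynomial, which is monic.
\<close>

lemma algebraic_int_if_stable:
  fixes v :: "'i \<Rightarrow> 'b::field_char_0"
  assumes J: "finite J" and nz: "i0 \<in> J" "v i0 \<noteq> 0"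
    and stable: "\<And>i. i \<in> J \<Longrightarrow> \<exists>c. x * v i = (\<Sum>j\<in>J. of_int (c j) * v j)"
  shows "algebraic_int x"
proof -
  obtain c where c: "\<And>i. i \<in> J \<Longrightarrow> x * v i = (\<Sum>j\<in>J. of_int (c i j) * v j)"
    using stable by metis
  define n where "n = card J"
  obtain h where h: "bij_betw h {..<n} J"
    using ex_bij_betw_nat_finite[OF J] by (auto simp: atLeast0LessThan n_def)
  define M where "M = mat n n (\<lambda>(i, j). c (h i) (h j))"
  define w where "w = vec n (\<lambda>j. v (h j))"
  have M: "M \<in> carrier_mat n n" by (simp add: M_def)
  let ?M = "map_mat of_int M :: 'b mat"
  have mult: "?M *\<^sub>v w = x \<cdot>\<^sub>v w"
  proof (rule eq_vecI)
    fix i assume "i < dim_vec (x \<cdot>\<^sub>v w)"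
    then have i: "i < n" by (simp add: w_def)
    then have "h i \<in> J" using h by (auto simp: bij_betw_def)
    have "(?M *\<^sub>v w) $ i = (\<Sum>j<n. of_int (c (h i) (h j)) * v (h j))"
      using i by (simp add: M_def w_def scalar_prod_def atLeast0LessThan)
    also have "\<dots> = (\<Sum>j\<in>J. of_int (c (h i) j) * v j)"
      by (rule sum.reindex_bij_betw[OF h])
    also have "\<dots> = (x \<cdot>\<^sub>v w) $ i" using c[OF \<open>h i \<in> J\<close>] i by (simp add: w_def)
    finally show "(?M *\<^sub>v w) $ i = (x \<cdot>\<^sub>v w) $ i" .
  qed (simp add: M_def w_def)
  obtain k where k: "k < n" "h k = i0" using h nz(1) by (metis bij_betw_iff_bijections lessThan_iff)
  have "w \<noteq> 0\<^sub>v n"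
  proof
    assume "w = 0\<^sub>v n"
    then have "w $ k = 0" using k by simp
    then show False using k nz by (simp add: w_def)
  qed
  then have "eigenvector ?M w x"
    using mult by (simp add: eigenvector_def M_def w_def)
  then have "poly (char_poly ?M) x = 0"
    using eigenvalue_root_char_poly[of ?M n x] M by (auto simp: eigenvalue_def)
  moreover have "char_poly ?M = map_poly of_int (char_poly M)"
    by (rule of_int_hom.char_poly_hom[OF M])
  moreover have "lead_coeff (char_poly M) = 1"
    using degree_monic_char_poly[OF M] by simp
  ultimately show ?thesis unfolding algebraic_int_altdef_ipoly by metis
qed

lemma algebraic_int_top_power:
  fixes x :: "'b::field_char_0"
  assumes "algebraic_int x"
  obtains m c where "m > 0" "x ^ m = (\<Sum>i<m. of_int (c i) * x ^ i)"
proof -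
  obtain p where p: "poly (map_poly of_int p) x = 0" "lead_coeff p = 1"
    using assms algebraic_int_altdef_ipoly by blast
  define m where "m = degree p"
  have "0 = (\<Sum>i\<le>m. of_int (poly.coeff p i) * x ^ i)"
    using p(1) by (simp add: poly_altdef degree_map_poly coeff_map_poly m_def)
  also have "\<dots> = (\<Sum>i<m. of_int (poly.coeff p i) * x ^ i) + x ^ m"
    using p(2) by (simp add: lessThan_Suc_atMost[symmetric] m_def)
  finally have eq: "x ^ m = (\<Sum>i<m. of_int (- poly.coeff p i) * x ^ i)"
    by (simp add: sum_negf eq_neg_iff_add_eq_0 add.commute)
  have "m > 0" using eq by (cases m) auto
  then show ?thesis using eq by (rule that)
qed

text \<open>
  The monomials \<open>x\<^sup>i y\<^sup>j\<close> of bounded degrees generate a group that is stable under both \<open>x\<close> and \<open>y\<close>.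
\<close>

lemma algebraic_int_add_mult:
  fixes x y :: "'b::field_char_0"
  assumes "algebraic_int x" "algebraic_int y"
  shows "algebraic_int (x + y)" "algebraic_int (x * y)"
proof -
  obtain m a where m: "m > 0" "x ^ m = (\<Sum>i<m. of_int (a i) * x ^ i)"
    using algebraic_int_top_power[OF assms(1)] by metis
  obtain n b where n: "n > 0" "y ^ n = (\<Sum>i<n. of_int (b i) * y ^ i)"
    using algebraic_int_top_power[OF assms(2)] by metis
  define J where "J = {..<m} \<times> {..<n}"
  define v where "v = (\<lambda>(i, j). x ^ i * y ^ j)"
  define comb where "comb c = (\<Sum>j\<in>J. of_int (c j) * v j)" for c :: "nat \<times> nat \<Rightarrow> int"
  define Z where "Z = range comb"
  have J: "finite J" by (simp add: J_def)
  have Z_add: "s + t \<in> Z" if st: "s \<in> Z" "t \<in> Z" for s t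
  proof -
    obtain c d where "s = comb c" "t = comb d" using st unfolding Z_def by blast
    then have "s + t = comb (\<lambda>j. c j + d j)" by (simp add: comb_def sum.distrib distrib_right)
    then show ?thesis unfolding Z_def by blast
  qed
  have Z_scale: "of_int k * s \<in> Z" if s: "s \<in> Z" for k s
  proof -
    obtain c where "s = comb c" using s unfolding Z_def by blast
    then have "of_int k * s = comb (\<lambda>j. k * c j)" by (simp add: comb_def sum_distrib_left mult_ac)
    then show ?thesis unfolding Z_def by blast
  qed
  have Z_v: "v j \<in> Z" if "j \<in> J" for j
  proof -
    have "v j = comb (\<lambda>i. if i = j then 1 else 0)"
      using that J by (simp add: comb_def if_distrib[of of_int] if_distrib[of "\<lambda>t. t * _"] cong: if_cong)
    then show ?thesis unfolding Z_def by blast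
  qed
  have "0 = comb (\<lambda>_. 0)" by (simp add: comb_def)
  then have Z0: "0 \<in> Z" unfolding Z_def by blast
  have Z_sum: "(\<Sum>i\<in>A. of_int (c i) * f i) \<in> Z" if "\<And>i. i \<in> A \<Longrightarrow> f i \<in> Z" for A c and f :: "nat \<Rightarrow> 'b"
    using that by (induction A rule: infinite_finite_induct) (auto intro!: Z0 Z_add Z_scale)
  have Z_sum2: "(\<Sum>i\<in>A. of_int (c i) * f i) \<in> Z" if "\<And>i. i \<in> A \<Longrightarrow> f i \<in> Z" for A c and f :: "nat \<times> nat \<Rightarrow> 'b"
    using that by (induction A rule: infinite_finite_induct) (auto intro!: Z0 Z_add Z_scale)
  have xv: "x * v j \<in> Z" if jJ: "j \<in> J" for j
  proof -
    obtain k l where j: "j = (k, l)" "k < m" "l < n" using jJ by (auto simp: J_def)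
    show ?thesis
    proof (cases "Suc k < m")
      case True
      then have "x * v j = v (Suc k, l)" "(Suc k, l) \<in> J" using j by (auto simp: v_def J_def)
      then show ?thesis using Z_v by simp
    next
      case False
      then have "Suc k = m" using j by simp
      then have "x * v j = x ^ m * y ^ l" using j by (auto simp: v_def)
      also have "\<dots> = (\<Sum>i<m. of_int (a i) * v (i, l))"
        unfolding m(2) v_def by (simp add: sum_distrib_right mult.assoc)
      also have "\<dots> \<in> Z" using j by (intro Z_sum Z_v) (simp add: J_def)
      finally show ?thesis .
    qed
  qed
  have yv: "y * v j \<in> Z" if jJ: "j \<in> J" for j
  proof -
    obtain k l where j: "j = (k, l)" "k < m" "l < n" using jJ by (auto simp: J_def)
    show ?thesis
    proof (cases "Suc l < n")
      case True
      then have "y * v j = v (k, Suc l)" "(k, Suc l) \<in> J" using j by (auto simp: v_def J_def)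
      then show ?thesis using Z_v by simp
    next
      case False
      then have "Suc l = n" using j by simp
      then have "y * v j = x ^ k * y ^ n" using j by (auto simp: v_def)
      also have "\<dots> = (\<Sum>i<n. of_int (b i) * v (k, i))"
        unfolding n(2) v_def by (simp add: sum_distrib_left mult_ac)
      also have "\<dots> \<in> Z" using j by (intro Z_sum Z_v) (simp add: J_def)
      finally show ?thesis .
    qed
  qed
  have x_stable: "x * s \<in> Z" if s: "s \<in> Z" for s
  proof -
    obtain c where "s = comb c" using s unfolding Z_def by blast
    then have "x * s = (\<Sum>j\<in>J. of_int (c j) * (x * v j))" by (simp add: comb_def sum_distrib_left mult_ac)
    then show ?thesis using Z_sum2 xv by simp
  qed
  have one: "(0, 0) \<in> J" "v (0, 0) \<noteq> 0" using m(1) n(1) by (auto simp: J_def v_def)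
  have "\<exists>c. (x + y) * v j = (\<Sum>i\<in>J. of_int (c i) * v i)" if "j \<in> J" for j
    using Z_add[OF xv[OF that] yv[OF that]] by (auto simp: Z_def comb_def distrib_right)
  from algebraic_int_if_stable[OF J one this] show "algebraic_int (x + y)" .
  have "\<exists>c. (x * y) * v j = (\<Sum>i\<in>J. of_int (c i) * v i)" if "j \<in> J" for j
    using x_stable[OF yv[OF that]] by (auto simp: Z_def comb_def mult.assoc)
  from algebraic_int_if_stable[OF J one this] show "algebraic_int (x * y)" .
qed

lemma algebraic_int_sum_prod:
  fixes f :: "'i \<Rightarrow> 'b::field_char_0"
  assumes "\<And>i. i \<in> A \<Longrightarrow> algebraic_int (f i)"
  shows "algebraic_int (sum f A)" "algebraic_int (prod f A)"
  using assms by (induction A rule: infinite_finite_induct) (auto simp: algebraic_int_add_mult)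

lemma algebraic_int_of_int: "algebraic_int (of_int k :: 'b::field_char_0)"
  by (rule int_imp_algebraic_int) simp

lemma algebraic_int_det:
  fixes M :: "'b::field_char_0 mat"
  assumes M: "M \<in> carrier_mat n n" and "\<And>i j. i < n \<Longrightarrow> j < n \<Longrightarrow> algebraic_int (M $$ (i, j))"
  shows "algebraic_int (det M)"
  unfolding det_def'[OF M]
proof (rule algebraic_int_sum_prod(1))
  fix p assume "p \<in> {p. p permutes {0..<n}}"
  then have "p i < n" if "i < n" for i using that permutes_in_image[of p "{0..<n}" i] by simp
  then have "algebraic_int (\<Prod>i = 0..<n. M $$ (i, p i))"
    using assms(2) by (intro algebraic_int_sum_prod(2)) simp
  moreover have "algebraic_int (signof p :: 'b)"
    using algebraic_int_of_int[of "sign p"] by (simp add: sign_def)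
  ultimately show "algebraic_int (signof p * (\<Prod>i = 0..<n. M $$ (i, p i)))"
    by (rule algebraic_int_add_mult(2)[rotated])
qed

text \<open>
  The multiplier is the leading coefficient of an integer polynomial that annihilates \<open>x\<close>:
  multiplication by \<open>kx\<close> maps the group generated by the powers of \<open>x\<close> below the degree into itself.
\<close>

lemma integral_multiple_exists:
  fixes x :: "'a::number_field"
  shows "\<exists>k::int. k \<noteq> 0 \<and> algebraic_int (of_int k * x)"
proof -
  obtain f where f: "poly (map_poly of_rat f) x = 0" "rsquarefree (map_poly of_rat f :: complex poly)"
    by (rule separable_annihilator)
  then have "f \<noteq> 0" by (auto simp: rsquarefree_def)
  have "algebraic x"
    using f(1) \<open>f \<noteq> 0\<close> by (intro algebraicI'[of "map_poly of_rat f"]) (auto simp: coeff_map_poly)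
  then obtain p where p: "p \<noteq> 0" "poly (map_poly of_int p) x = 0" by (rule algebraicE')
  define n where "n = degree p"
  define k where "k = lead_coeff p"
  have "k \<noteq> 0" using p by (simp add: k_def)
  have "0 = (\<Sum>i\<le>n. of_int (poly.coeff p i) * x ^ i)"
    using p(2) by (simp add: poly_altdef degree_map_poly coeff_map_poly n_def)
  also have "\<dots> = (\<Sum>i<n. of_int (poly.coeff p i) * x ^ i) + of_int k * x ^ n"
    by (simp add: lessThan_Suc_atMost[symmetric] n_def k_def)
  finally have top: "of_int k * x ^ n = (\<Sum>i<n. of_int (- poly.coeff p i) * x ^ i)"
    by (simp add: sum_negf eq_neg_iff_add_eq_0 add.commute)
  have "n > 0" using top \<open>k \<noteq> 0\<close> by (cases n) auto
  have "\<exists>c. (of_int k * x) * x ^ i = (\<Sum>j\<in>{..<n}. of_int (c j) * x ^ j)" if "i \<in> {..<n}" for i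
  proof (cases "Suc i = n")
    case True
    then have "of_int k * x * x ^ i = of_int k * x ^ n" by auto
    then show ?thesis unfolding top by (intro exI[of _ "\<lambda>j. - poly.coeff p j"])
  next
    case False
    then have "of_int k * x * x ^ i = (\<Sum>j\<in>{..<n}. of_int (if j = Suc i then k else 0) * x ^ j)"
      using that by (subst sum.remove[of _ "Suc i"]) auto
    then show ?thesis by (rule exI[of _ "\<lambda>j. if j = Suc i then k else 0"])
  qed
  from algebraic_int_if_stable[of "{..<n}" 0 "\<lambda>i. x ^ i", OF _ _ _ this] \<open>n > 0\<close> \<open>k \<noteq> 0\<close>
  show ?thesis by auto
qed

lemma algebraic_int_embedding:
  assumes "\<sigma> \<in> embeddings" "algebraic_int x"
  shows "algebraic_int (\<sigma> x)"
proof -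
  obtain m c where m: "m > 0" "x ^ m = (\<Sum>i<m. of_int (c i) * x ^ i)"
    using algebraic_int_top_power[OF assms(2)] by metis
  have "\<sigma> x ^ m = \<sigma> (\<Sum>i<m. of_int (c i) * x ^ i)"
    unfolding m(2)[symmetric] by (rule embedding_rules(7)[OF assms(1), symmetric])
  also have "\<dots> = (\<Sum>i<m. of_int (c i) * \<sigma> x ^ i)"
    unfolding rat_linear_sum[OF embedding_rat_linear[OF assms(1)]]
    by (simp only: embedding_rules[OF assms(1)])
  finally have s: "\<sigma> x ^ m = (\<Sum>i<m. of_int (c i) * \<sigma> x ^ i)" .
  have "\<exists>d. \<sigma> x * \<sigma> x ^ i = (\<Sum>j\<in>{..<m}. of_int (d j) * \<sigma> x ^ j)" if "i \<in> {..<m}" for i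
  proof (cases "Suc i = m")
    case True
    then have "\<sigma> x * \<sigma> x ^ i = \<sigma> x ^ m" by auto
    then show ?thesis unfolding s by (intro exI[of _ c])
  next
    case False
    then have "\<sigma> x * \<sigma> x ^ i = (\<Sum>j\<in>{..<m}. of_int (if j = Suc i then 1 else 0) * \<sigma> x ^ j)"
      using that by (simp add: if_distrib[of of_int] if_distrib[of "\<lambda>t. t * _"] cong: if_cong)
    then show ?thesis by (rule exI[of _ "\<lambda>j. if j = Suc i then 1 else 0"])
  qed
  from algebraic_int_if_stable[of "{..<m}" 0 "\<lambda>i. \<sigma> x ^ i", OF _ _ _ this] m(1)
  show ?thesis by auto
qed


section \<open>Discriminants\<close>

definition embedding_mat :: "'a::number_field list \<Rightarrow> complex mat" where
  "embedding_mat \<gamma> = (let d = nf_degree TYPE('a) in mat d d (\<lambda>(j, k). nth_embedding j (\<gamma> ! k)))"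

lemma disc_eq: "disc \<gamma> = (det (embedding_mat \<gamma>))\<^sup>2"
  by (simp add: disc_def embedding_mat_def Let_def)

lemma embedding_mat_carrier [simp]:
  "embedding_mat (\<gamma> :: 'a list) \<in> carrier_mat (nf_degree TYPE('a::number_field)) (nf_degree TYPE('a))"
  by (simp add: embedding_mat_def Let_def)

lemma embedding_mat_index:
  "j < nf_degree TYPE('a) \<Longrightarrow> k < nf_degree TYPE('a) \<Longrightarrow>
    embedding_mat (\<gamma> :: 'a::number_field list) $$ (j, k) = nth_embedding j (\<gamma> ! k)"
  by (simp add: embedding_mat_def Let_def)

lemma nth_embedding_mem:
  "j < nf_degree TYPE('a) \<Longrightarrow> (nth_embedding j :: 'a::number_field \<Rightarrow> complex) \<in> embeddings"
  using nth_embedding_bij by (auto simp: bij_betw_def)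

lemma embedding_nth:
  assumes "\<sigma> \<in> (embeddings :: ('a::number_field \<Rightarrow> complex) set)"
  obtains j where "j < nf_degree TYPE('a)" "\<sigma> = nth_embedding j"
  using assms nth_embedding_bij[where 'a = 'a] by (auto simp: bij_betw_def)

text \<open>
  An embedding is rational-linear, so it commutes with a rational change of generators.
\<close>

lemma det_embedding_mat_change:
  fixes \<gamma> \<delta> :: "'a::number_field list"
  assumes "\<And>k. k < nf_degree TYPE('a) \<Longrightarrow> \<gamma> ! k = (\<Sum>i<nf_degree TYPE('a). of_rat (m i k) * \<delta> ! i)"
  shows "det (embedding_mat \<gamma>) = det (embedding_mat \<delta>) *
    of_rat (det (mat (nf_degree TYPE('a)) (nf_degree TYPE('a)) (\<lambda>(i, k). m i k)))"
proof -
  let ?d = "nf_degree TYPE('a)"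
  define M where "M = mat ?d ?d (\<lambda>(i, k). m i k)"
  have M: "M \<in> carrier_mat ?d ?d" by (simp add: M_def)
  have "embedding_mat \<gamma> = embedding_mat \<delta> * map_mat of_rat M"
  proof (rule eq_matI)
    fix j k assume jk: "j < dim_row (embedding_mat \<delta> * map_mat of_rat M)"
      "k < dim_col (embedding_mat \<delta> * map_mat of_rat M)"
    then have j: "j < ?d" and k: "k < ?d" using embedding_mat_carrier[of \<delta>] M by auto
    note lin = embedding_rat_linear[OF nth_embedding_mem[OF j]]
    have "nth_embedding j (\<gamma> ! k) = (\<Sum>i<?d. nth_embedding j (\<delta> ! i) * of_rat (m i k))"
      unfolding assms[OF k] rat_linear_sum[OF lin] using lin by (simp add: rat_linear_def mult.commute)
    also have "\<dots> = (embedding_mat \<delta> * map_mat of_rat M) $$ (j, k)"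
      using j k jk by (simp add: scalar_prod_def atLeast0LessThan embedding_mat_def Let_def M_def)
    finally show "embedding_mat \<gamma> $$ (j, k) = (embedding_mat \<delta> * map_mat of_rat M) $$ (j, k)"
      using j k by (simp add: embedding_mat_index)
  qed (auto simp: embedding_mat_def Let_def M_def)
  then show ?thesis
    using det_mult[OF embedding_mat_carrier[of \<delta>], of "map_mat of_rat M"] M
    by (simp add: of_rat_hom.hom_det M_def)
qed

lemma det_embedding_mat_basis:
  fixes b :: "'a::number_field list"
  assumes b: "rat_basis b"
  shows "det (embedding_mat b) \<noteq> 0"
proof
  let ?d = "nf_degree TYPE('a)"
  assume "det (embedding_mat b) = 0"
  then obtain v where v: "v \<in> carrier_vec ?d" "v \<noteq> 0\<^sub>v ?d" "embedding_mat b *\<^sub>v v = 0\<^sub>v ?d"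
    using det_0_iff_vec_prod_zero_field[OF embedding_mat_carrier[of b]] by blast
  have "(\<Sum>k<length b. \<sigma> (b ! k) * v $ k) = 0" if \<sigma>: "\<sigma> \<in> embeddings" for \<sigma>
  proof -
    obtain j where j: "j < ?d" "\<sigma> = nth_embedding j" using \<sigma> by (rule embedding_nth)
    have "(embedding_mat b *\<^sub>v v) $ j = (\<Sum>k<?d. \<sigma> (b ! k) * v $ k)"
      using j v(1) by (simp add: embedding_mat_def Let_def scalar_prod_def atLeast0LessThan)
    then show ?thesis using v(3) j length_rat_basis[OF b] by simp
  qed
  from embeddings_separate_combinations[OF b this] have "v $ k = 0" if "k < ?d" for k
    using that length_rat_basis[OF b] by simp
  then have "v = 0\<^sub>v ?d" using v(1) by (intro eq_vecI) auto
  with v(2) show False by blast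
qed

lemma span_list_combination:
  fixes xs :: "'a::number_field list"
  assumes "x \<in> rat_span (set xs)"
  obtains q where "x = (\<Sum>i<length xs. of_rat (q i) * xs ! i)"
proof -
  have "\<exists>q. x = (\<Sum>i<length xs. of_rat (q i) * xs ! i)"
    using assms
  proof (induction rule: rat_vs.span_induct_alt)
    case base
    show ?case by (intro exI[of _ "\<lambda>_. 0"]) simp
  next
    case (step c x y)
    then obtain q k where q: "y = (\<Sum>i<length xs. of_rat (q i) * xs ! i)" and k: "k < length xs" "x = xs ! k"
      by (metis in_set_conv_nth)
    have "of_rat c * x + y = (\<Sum>i<length xs. of_rat (q i + (if i = k then c else 0)) * xs ! i)"
      using k unfolding q
      by (simp add: of_rat_add distrib_right sum.distrib if_distrib[of of_rat] if_distrib[of "\<lambda>t. t * _"]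
          cong: if_cong)
    then show ?case by (rule exI[of _ "\<lambda>i. q i + (if i = k then c else 0)"])
  qed
  then show ?thesis using that by blast
qed

lemma span_if_expands_basis:
  fixes b :: "'a::number_field list"
  assumes "rat_basis b" "set b \<subseteq> rat_span S"
  shows "rat_span S = UNIV"
  using rat_vs.span_mono[OF assms(2)] assms(1) by (auto simp: rat_basis_def rat_vs.span_span)

lemma disc_nonzero_iff:
  fixes \<gamma> :: "'a::number_field list"
  assumes len: "length \<gamma> = nf_degree TYPE('a)"
  shows "disc \<gamma> \<noteq> 0 \<longleftrightarrow> rat_span (set \<gamma>) = UNIV"
proof
  let ?d = "nf_degree TYPE('a)"
  obtain b :: "'a list" where b: "rat_basis b"
    using rat_basis_exists_within[of UNIV] by (metis rat_vs.span_UNIV)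
  note lb = length_rat_basis[OF b]
  {
    assume span: "rat_span (set \<gamma>) = UNIV"
    have "\<exists>q. b ! k = (\<Sum>i<?d. of_rat (q i) * \<gamma> ! i)" for k
      using span_list_combination[of "b ! k" \<gamma>] span len by (metis UNIV_I)
    then obtain q where "\<And>k. b ! k = (\<Sum>i<?d. of_rat (q k i) * \<gamma> ! i)" by metis
    from det_embedding_mat_change[of b "\<lambda>i k. q k i" \<gamma>, OF this] det_embedding_mat_basis[OF b]
    show "disc \<gamma> \<noteq> 0" by (auto simp: disc_eq)
  }
  assume nz: "disc \<gamma> \<noteq> 0"
  define C where "C = mat ?d ?d (\<lambda>(i, k). coord b i (\<gamma> ! k))"
  have C: "C \<in> carrier_mat ?d ?d" by (simp add: C_def)
  have "\<gamma> ! k = (\<Sum>i<?d. of_rat (coord b i (\<gamma> ! k)) * b ! i)" for k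
    using basis_expansion[OF b] lb by simp
  from det_embedding_mat_change[OF this] nz have "det C \<noteq> 0" by (auto simp: disc_eq C_def)
  then obtain D where D: "D \<in> carrier_mat ?d ?d" "C * D = 1\<^sub>m ?d"
    using det_non_zero_imp_unit[OF C] unfolding Units_def ring_mat_def by auto
  have "b ! i \<in> rat_span (set \<gamma>)" if i: "i < ?d" for i
  proof -
    have "(\<Sum>k<?d. of_rat (D $$ (k, i)) * \<gamma> ! k)
        = (\<Sum>k<?d. \<Sum>l<?d. of_rat (C $$ (l, k) * D $$ (k, i)) * b ! l)"
      using lb by (intro sum.cong refl, subst basis_expansion[OF b, of "\<gamma> ! _"])
        (simp add: C_def sum_distrib_left of_rat_mult mult_ac)
    also have "\<dots> = (\<Sum>l<?d. of_rat (\<Sum>k<?d. C $$ (l, k) * D $$ (k, i)) * b ! l)"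
      by (subst sum.swap) (simp add: of_rat_sum sum_distrib_right)
    also have "\<dots> = (\<Sum>l<?d. of_rat ((C * D) $$ (l, i)) * b ! l)"
      using i C D(1) by (intro sum.cong refl) (simp add: scalar_prod_def atLeast0LessThan)
    also have "\<dots> = b ! i"
      using i by (simp add: D(2) if_distrib[of of_rat] if_distrib[of "\<lambda>t. t * _"] cong: if_cong)
    finally have "b ! i = (\<Sum>k<?d. of_rat (D $$ (k, i)) * \<gamma> ! k)" by simp
    also have "\<dots> \<in> rat_span (set \<gamma>)"
      using len by (intro rat_vs.span_sum rat_vs.span_scale rat_vs.span_base nth_mem) simp
    finally show ?thesis .
  qed
  then have "set b \<subseteq> rat_span (set \<gamma>)" using lb by (auto simp: in_set_conv_nth)
  then show "rat_span (set \<gamma>) = UNIV" by (rule span_if_expands_basis[OF b])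
qed

lemma rat_basis_if_spans:
  fixes \<gamma> :: "'a::number_field list"
  assumes "length \<gamma> = nf_degree TYPE('a)" "rat_span (set \<gamma>) = UNIV"
  shows "rat_basis \<gamma>"
proof -
  obtain b where b: "rat_basis b" "set b \<subseteq> set \<gamma>"
    using rat_basis_exists_within[OF assms(2)] by blast
  have "card (set b) = length \<gamma>" using b(1) length_rat_basis[OF b(1)] assms(1)
    by (simp add: rat_basis_def distinct_card)
  then have "card (set \<gamma>) = length \<gamma>" "set b = set \<gamma>"
    using card_mono[OF _ b(2)] card_length[of \<gamma>] card_subset_eq[OF _ b(2)] by auto
  then show ?thesis using b(1) by (auto simp: rat_basis_def card_distinct)
qed

text \<open>
  The sum of the conjugates of \<open>x\<close> is the trace of the multiplication by \<open>x\<close>, computed from coordinates.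
  Let \<open>S\<close> be the embedding matrix of a basis.  With \<open>C\<close> expressing the coordinate functionals through the embeddings, \<open>C S = 1\<close> holds by construction; what
  the trace formula needs is \<open>S C = 1\<close>.
\<close>

lemma sum_embeddings_rational: "(\<Sum>\<sigma>\<in>embeddings. \<sigma> (x::'a::number_field)) \<in> \<rat>"
proof -
  let ?d = "nf_degree TYPE('a)"
  obtain b :: "'a list" where b: "rat_basis b"
    using rat_basis_exists_within[of UNIV] by (metis rat_vs.span_UNIV)
  note lb = length_rat_basis[OF b]
  have "\<exists>c. \<forall>y. of_rat (coord b i y) = (\<Sum>\<sigma>\<in>embeddings. c \<sigma> * \<sigma> y)" for i
  proof -
    have "rat_linear (\<lambda>y. of_rat (coord b i y))"
      using b by (simp add: rat_linear_def coord_add coord_scale of_rat_add of_rat_mult)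
    then show ?thesis using functional_eq_embedding_combination by blast
  qed
  then obtain c where c: "\<And>i y. of_rat (coord b i y) = (\<Sum>\<sigma>\<in>embeddings. c i \<sigma> * \<sigma> y)" by metis
  have emb: "(\<Sum>\<sigma>\<in>embeddings. f \<sigma>) = (\<Sum>j<?d. f (nth_embedding j))" for f :: "('a \<Rightarrow> complex) \<Rightarrow> complex"
    by (rule sum.reindex_bij_betw[OF nth_embedding_bij, symmetric])
  define C where "C = mat ?d ?d (\<lambda>(i, j). c i (nth_embedding j))"
  have C: "C \<in> carrier_mat ?d ?d" by (simp add: C_def)
  have "C * embedding_mat b = 1\<^sub>m ?d"
  proof (rule eq_matI)
    fix i k assume "i < dim_row (1\<^sub>m ?d :: complex mat)" "k < dim_col (1\<^sub>m ?d :: complex mat)"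
    then have i: "i < ?d" and k: "k < ?d" by auto
    have "(C * embedding_mat b) $$ (i, k) = (\<Sum>j<?d. c i (nth_embedding j) * nth_embedding j (b ! k))"
      using i k C by (simp add: embedding_mat_def Let_def scalar_prod_def atLeast0LessThan C_def)
    also have "\<dots> = of_rat (coord b i (b ! k))" by (simp only: c emb)
    also have "\<dots> = 1\<^sub>m ?d $$ (i, k)" using i k lb b by (simp add: coord_basis)
    finally show "(C * embedding_mat b) $$ (i, k) = 1\<^sub>m ?d $$ (i, k)" .
  qed (use C in \<open>auto simp: embedding_mat_def Let_def\<close>)
  then have inv: "embedding_mat b * C = 1\<^sub>m ?d"
    by (rule mat_mult_left_right_inverse[OF C embedding_mat_carrier])
  have diag: "(\<Sum>i<?d. nth_embedding j (b ! i) * c i (nth_embedding j)) = 1" if j: "j < ?d" for j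
  proof -
    have "(\<Sum>i<?d. nth_embedding j (b ! i) * c i (nth_embedding j)) = (embedding_mat b * C) $$ (j, j)"
      using j C by (simp add: embedding_mat_def Let_def scalar_prod_def atLeast0LessThan C_def)
    then show ?thesis using j by (simp add: inv)
  qed
  have "of_rat (\<Sum>i<?d. coord b i (x * b ! i))
      = (\<Sum>i<?d. \<Sum>j<?d. c i (nth_embedding j) * nth_embedding j (x * b ! i))"
    by (simp only: of_rat_sum c emb)
  also have "\<dots> = (\<Sum>j<?d. nth_embedding j x * (\<Sum>i<?d. nth_embedding j (b ! i) * c i (nth_embedding j)))"
    by (subst sum.swap)
      (simp add: sum_distrib_left embedding_rules[OF nth_embedding_mem] mult_ac)
  also have "\<dots> = (\<Sum>j<?d. nth_embedding j x)" by (simp add: diag)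
  also have "\<dots> = (\<Sum>\<sigma>\<in>embeddings. \<sigma> x)" by (rule emb[symmetric])
  finally show ?thesis by (rule subst[where P = "\<lambda>z. z \<in> \<rat>"]) (rule Rats_of_rat)
qed

text \<open>
  The discriminant is an algebraic integer, being a polynomial in conjugates of algebraic integers.  It
  is rational because it is the determinant of the trace matrix \<open>S\<^sup>T S\<close>, where \<open>S\<close> is the
  embedding matrix.
\<close>

lemma disc_integral_in_Ints:
  fixes \<gamma> :: "'a::number_field list"
  assumes "length \<gamma> = nf_degree TYPE('a)" "set \<gamma> \<subseteq> ring_of_integers"
  shows "disc \<gamma> \<in> \<int>"
proof (rule rational_algebraic_int_is_int)
  let ?d = "nf_degree TYPE('a)" and ?S = "embedding_mat \<gamma>"
  have S: "?S \<in> carrier_mat ?d ?d" by simp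
  have "algebraic_int (\<gamma> ! k)" if "k < ?d" for k
  proof -
    have "\<gamma> ! k \<in> set \<gamma>" using that assms(1) by simp
    then show ?thesis using assms(2) by (auto simp: ring_of_integers_def)
  qed
  then have "algebraic_int (det ?S)"
    by (intro algebraic_int_det[OF S])
      (simp add: embedding_mat_index algebraic_int_embedding[OF nth_embedding_mem])
  then show "algebraic_int (disc \<gamma>)"
    unfolding disc_eq power2_eq_square by (intro algebraic_int_add_mult(2))
  have "\<forall>i k. \<exists>q. (\<Sum>\<sigma>\<in>embeddings. \<sigma> (\<gamma> ! i * \<gamma> ! k)) = of_rat q"
    using sum_embeddings_rational by (metis Rats_cases)
  then obtain t where t: "\<And>i k. (\<Sum>\<sigma>\<in>embeddings. \<sigma> (\<gamma> ! i * \<gamma> ! k)) = of_rat (t i k)" by metis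
  define T where "T = mat ?d ?d (\<lambda>(i, k). t i k)"
  have "transpose_mat ?S * ?S = map_mat of_rat T"
  proof (rule eq_matI)
    fix i k assume "i < dim_row (map_mat of_rat T :: complex mat)" "k < dim_col (map_mat of_rat T :: complex mat)"
    then have i: "i < ?d" and k: "k < ?d" by (auto simp: T_def)
    have "(transpose_mat ?S * ?S) $$ (i, k) = (\<Sum>j<?d. nth_embedding j (\<gamma> ! i) * nth_embedding j (\<gamma> ! k))"
      using i k by (simp add: embedding_mat_def Let_def scalar_prod_def atLeast0LessThan)
    also have "\<dots> = (\<Sum>j<?d. nth_embedding j (\<gamma> ! i * \<gamma> ! k))"
      by (simp add: embedding_rules[OF nth_embedding_mem])
    also have "\<dots> = of_rat (t i k)"
      unfolding t[symmetric] by (rule sum.reindex_bij_betw[OF nth_embedding_bij])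
    finally show "(transpose_mat ?S * ?S) $$ (i, k) = map_mat of_rat T $$ (i, k)"
      using i k by (simp add: T_def)
  qed (auto simp: T_def embedding_mat_def Let_def)
  then have "det (transpose_mat ?S) * det ?S = of_rat (det T)"
    using det_mult[of "transpose_mat ?S" ?d ?S] S by (simp add: of_rat_hom.hom_det)
  then have "disc \<gamma> = of_rat (det T)" by (simp add: disc_eq power2_eq_square det_transpose[OF S])
  then show "disc \<gamma> \<in> \<rat>" by simp
qed



section \<open>Integral bases\<close>

lemma ring_of_integers_closed:
  fixes x y :: "'a::number_field"
  shows "x \<in> ring_of_integers \<Longrightarrow> y \<in> ring_of_integers \<Longrightarrow> x - of_int k * y \<in> ring_of_integers"
  unfolding ring_of_integers_def mem_Collect_eq
  using algebraic_int_add_mult(1)[of x "- (of_int k * y)"] algebraic_int_add_mult(2)[OF algebraic_int_of_int, of y k]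
  by simp

lemma coord_combination:
  fixes b :: "'a::number_field list"
  assumes b: "rat_basis b" and i: "i < length b"
  shows "coord b i (\<Sum>j<length b. of_rat (q j) * b ! j) = q i"
proof -
  have zero: "coord b i 0 = 0" using coord_scale[OF b, of i 0 0] by simp
  have sum: "coord b i (\<Sum>j\<in>A. f j) = (\<Sum>j\<in>A. coord b i (f j))" for A and f :: "nat \<Rightarrow> 'a"
    by (induction A rule: infinite_finite_induct) (simp_all add: zero coord_add[OF b])
  show ?thesis
    using i by (simp add: sum coord_scale[OF b] coord_basis[OF b] if_distrib[of "(*) _"] cong: if_cong)
qed

lemma integral_basis_of_integral_coords:
  fixes b :: "'a::number_field list"
  assumes b: "rat_basis b" "set b \<subseteq> ring_of_integers"
    and int: "\<And>x i. x \<in> ring_of_integers \<Longrightarrow> i < length b \<Longrightarrow> coord b i x \<in> \<int>"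
  shows "integral_basis b"
  unfolding integral_basis_def
proof (intro conjI ballI)
  show "length b = nf_degree TYPE('a)" by (rule length_rat_basis[OF b(1)])
  show "set b \<subseteq> ring_of_integers" by (rule b(2))
  fix x :: 'a assume x: "x \<in> ring_of_integers"
  define c where "c = map (\<lambda>i. \<lfloor>coord b i x\<rfloor>) [0..<length b]"
  have c: "of_int (c ! i) = coord b i x" if "i < length b" for i
    using int[OF x that] that by (auto simp: c_def elim: Ints_cases)
  show "\<exists>!c :: int list. length c = length b \<and> x = (\<Sum>i<length b. of_int (c ! i) * b ! i)"
  proof (rule ex1I[of _ c])
    have "x = (\<Sum>i<length b. of_rat (of_int (c ! i)) * b ! i)"
      by (subst basis_expansion[OF b(1), of x]) (intro sum.cong refl, simp only: c lessThan_iff)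
    then show "length c = length b \<and> x = (\<Sum>i<length b. of_int (c ! i) * b ! i)"
      by (simp add: c_def)
  next
    fix c' :: "int list" assume c': "length c' = length b \<and> x = (\<Sum>i<length b. of_int (c' ! i) * b ! i)"
    then have "x = (\<Sum>i<length b. of_rat (of_int (c' ! i)) * b ! i)" by simp
    then have "coord b i x = of_int (c' ! i)" if "i < length b" for i
      using coord_combination[OF b(1) that, of "\<lambda>j. of_int (c' ! j)"] by simp
    then have "c' ! i = c ! i" if "i < length b" for i using c[OF that] that by (metis of_int_eq_iff)
    then show "c' = c" using c' by (intro nth_equalityI) (auto simp: c_def)
  qed
qed

text \<open>
  Among the bases that consist of algebraic integers, take one whose discriminant has least absolute
  value.  If an algebraic integer \<open>x\<close> had a non-integral coordinate, say at \<open>b\<^sub>i\<close>, then replacing \<open>b\<^sub>i\<close> by \<open>x\<close> minus a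
  multiple of \<open>b\<^sub>i\<close> would leave the fractional part \<open>f\<close> as that coordinate.  By Cramer's rule this multiplies the
  discriminant by \<open>f\<^sup>2\<close>, which is strictly between 0 and 1.
\<close>

lemma integral_basis_exists: "\<exists>\<omega> :: 'a::number_field list. integral_basis \<omega>"
proof -
  let ?d = "nf_degree TYPE('a)"
  let ?P = "\<lambda>b :: 'a list. rat_basis b \<and> set b \<subseteq> ring_of_integers"
  let ?m = "\<lambda>b :: 'a list. nat \<lfloor>cmod (disc b)\<rfloor>"
  have "x \<in> rat_span ring_of_integers" for x :: 'a
  proof -
    obtain k :: int where k: "k \<noteq> 0" "algebraic_int (of_int k * x)" using integral_multiple_exists by blast
    then have "of_rat (1 / of_int k) * (of_int k * x) \<in> rat_span ring_of_integers"
      by (intro rat_vs.span_scale rat_vs.span_base) (simp add: ring_of_integers_def)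
    moreover have "of_rat (1 / of_int k) * (of_int k * x) = x"
      using k(1) by (simp add: of_rat_divide)
    ultimately show ?thesis by simp
  qed
  then have "rat_span (ring_of_integers :: 'a set) = UNIV" by blast
  then obtain b0 :: "'a list" where "?P b0" by (rule rat_basis_exists_within) blast
  then obtain b where b: "?P b" and min: "\<And>b'. ?P b' \<Longrightarrow> ?m b \<le> ?m b'"
    using ex_has_least_nat[of ?P b0 ?m] by blast
  have rb: "rat_basis b" using b by blast
  note lb = length_rat_basis[OF rb]
  have "coord b i x \<in> \<int>" if x: "x \<in> ring_of_integers" and i: "i < length b" for x i
  proof (rule ccontr)
    assume nint: "coord b i x \<notin> \<int>"
    define f where "f = frac (coord b i x)"
    have f: "0 < f" "f < 1" using nint by (auto simp: f_def frac_lt_1 frac_gt_0_iff)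
    define y where "y = x - of_int \<lfloor>coord b i x\<rfloor> * b ! i"
    have "b ! i \<in> ring_of_integers" using b i by (auto intro: nth_mem)
    then have y: "y \<in> ring_of_integers" unfolding y_def using x by (intro ring_of_integers_closed)
    have "y = x + of_rat (- of_int \<lfloor>coord b i x\<rfloor>) * b ! i" by (simp add: y_def of_rat_minus)
    then have cy: "coord b i y = f"
      using i by (simp only: coord_add[OF rb] coord_scale[OF rb] coord_basis[OF rb] f_def frac_def) simp
    define b' where "b' = b[i := y]"
    have lb': "length b' = ?d" using lb by (simp add: b'_def)
    define v where "v = vec ?d (\<lambda>k. of_rat (coord b k y) :: complex)"
    have "embedding_mat b' = replace_col (embedding_mat b) (embedding_mat b *\<^sub>v v) i"
    proof (rule eq_matI)
      fix j k assume "j < dim_row (replace_col (embedding_mat b) (embedding_mat b *\<^sub>v v) i)"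
        "k < dim_col (replace_col (embedding_mat b) (embedding_mat b *\<^sub>v v) i)"
      then have j: "j < ?d" and k: "k < ?d" by (auto simp: replace_col_def embedding_mat_def Let_def)
      note lin = embedding_rat_linear[OF nth_embedding_mem[OF j]]
      have "nth_embedding j y = (\<Sum>k<?d. nth_embedding j (b ! k) * of_rat (coord b k y))"
        using basis_expansion[OF rb, of y] lin unfolding lb
        by (subst basis_expansion[OF rb, of y], unfold lb rat_linear_sum[OF lin])
          (simp add: rat_linear_def mult.commute)
      also have "\<dots> = (embedding_mat b *\<^sub>v v) $ j"
        using j by (simp add: embedding_mat_def Let_def v_def scalar_prod_def atLeast0LessThan)
      finally show "embedding_mat b' $$ (j, k) = replace_col (embedding_mat b) (embedding_mat b *\<^sub>v v) i $$ (j, k)"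
        using j k lb i by (auto simp: replace_col_def embedding_mat_def Let_def b'_def)
    qed (auto simp: replace_col_def embedding_mat_def Let_def)
    then have "det (embedding_mat b') = of_rat f * det (embedding_mat b)"
      using cramer_lemma_mat[OF embedding_mat_carrier[of b], of v i] i lb cy by (simp add: v_def)
    then have db': "disc b' = of_rat (f\<^sup>2) * disc b"
      by (simp add: disc_eq power_mult_distrib of_rat_power)
    have db: "disc b \<noteq> 0" using det_embedding_mat_basis[OF rb] by (simp add: disc_eq)
    then have "disc b' \<noteq> 0" using f db' by simp
    then have "rat_basis b'" using lb' disc_nonzero_iff rat_basis_if_spans by blast
    moreover have "set b' \<subseteq> ring_of_integers"
      using b y set_update_subset_insert[of b i y] by (auto simp: b'_def)
    ultimately have P': "?P b'" by blast
    have integral: "\<exists>z::int. disc c = of_int z \<and> ?m c = nat \<bar>z\<bar>" if Pc: "?P c" for c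
    proof -
      obtain z where "disc c = of_int z"
        using disc_integral_in_Ints[of c] length_rat_basis[of c] Pc by (auto elim: Ints_cases)
      then show ?thesis by (intro exI[of _ z]) (simp add: norm_of_int flip: of_int_abs)
    qed
    obtain z z' :: int where z: "disc b = of_int z" "?m b = nat \<bar>z\<bar>" "disc b' = of_int z'" "?m b' = nat \<bar>z'\<bar>"
      using integral[OF b] integral[OF P'] by blast
    have "of_int z' = (of_rat (f\<^sup>2 * of_int z) :: complex)" using db' z by (simp add: of_rat_mult)
    then have "of_int z' = f\<^sup>2 * of_int z" by (metis of_rat_eq_iff of_rat_of_int_eq)
    then have "of_int \<bar>z'\<bar> = f\<^sup>2 * of_int \<bar>z\<bar>" by (simp add: abs_mult)
    moreover have "f\<^sup>2 < 1" using f by (simp add: power_less_one_iff)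
    moreover have "z \<noteq> 0" using db z by auto
    ultimately have "of_int \<bar>z'\<bar> < (of_int \<bar>z\<bar> :: rat)" by simp
    then have "\<bar>z'\<bar> < \<bar>z\<bar>" by (simp only: of_int_less_iff)
    then have "?m b' < ?m b" unfolding z(2) z(4) by linarith
    with min[OF P'] show False by simp
  qed
  with integral_basis_of_integral_coords[OF rb] b show ?thesis by blast
qed

lemma integral_basis_spans:
  fixes \<omega> :: "'a::number_field list"
  assumes "integral_basis \<omega>"
  shows "rat_span (set \<omega>) = UNIV"
proof -
  have "x \<in> rat_span (set \<omega>)" for x
  proof -
    obtain k :: int where k: "k \<noteq> 0" "algebraic_int (of_int k * x)" using integral_multiple_exists by blast
    then have "of_int k * x \<in> ring_of_integers" by (simp add: ring_of_integers_def)
    then obtain c where "of_int k * x = (\<Sum>i<length \<omega>. of_int (c ! i) * \<omega> ! i)"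
      using assms unfolding integral_basis_def by blast
    also have "\<dots> = (\<Sum>i<length \<omega>. of_rat (of_int (c ! i)) * \<omega> ! i)" by simp
    also have "\<dots> \<in> rat_span (set \<omega>)"
      by (intro rat_vs.span_sum rat_vs.span_scale rat_vs.span_base nth_mem) simp
    finally have "of_rat (1 / of_int k) * (of_int k * x) \<in> rat_span (set \<omega>)"
      by (rule rat_vs.span_scale)
    moreover have "of_rat (1 / of_int k) * (of_int k * x) = x"
      using k(1) by (simp add: of_rat_divide)
    ultimately show ?thesis by simp
  qed
  then show ?thesis by blast
qed

lemma field_disc_nonzero: "field_disc TYPE('a::number_field) \<noteq> 0"
  and disc_integral_multiple:
    "length \<gamma> = nf_degree TYPE('a) \<Longrightarrow> set \<gamma> \<subseteq> ring_of_integers \<Longrightarrow>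
      \<exists>z::int. disc (\<gamma> :: 'a list) = of_int z ^ 2 * field_disc TYPE('a)"
proof -
  define \<omega> where "\<omega> = (SOME \<omega> :: 'a list. integral_basis \<omega>)"
  have \<omega>: "integral_basis \<omega>" unfolding \<omega>_def by (rule someI_ex[OF integral_basis_exists])
  have fd: "field_disc TYPE('a) = disc \<omega>" by (simp add: field_disc_def \<omega>_def)
  have len: "length \<omega> = nf_degree TYPE('a)" using \<omega> by (simp add: integral_basis_def)
  show "field_disc TYPE('a) \<noteq> 0"
    unfolding fd disc_nonzero_iff[OF len] by (rule integral_basis_spans[OF \<omega>])
  assume \<gamma>: "length \<gamma> = nf_degree TYPE('a)" "set \<gamma> \<subseteq> ring_of_integers"
  have "\<exists>c. \<gamma> ! k = (\<Sum>i<nf_degree TYPE('a). of_int (c ! i) * \<omega> ! i)" if "k < nf_degree TYPE('a)" for k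
  proof -
    have "\<gamma> ! k \<in> ring_of_integers" using \<gamma> that by (auto intro: nth_mem)
    then show ?thesis using \<omega> unfolding integral_basis_def len by blast
  qed
  then obtain c where "\<And>k. k < nf_degree TYPE('a) \<Longrightarrow>
      \<gamma> ! k = (\<Sum>i<nf_degree TYPE('a). of_int (c k ! i) * \<omega> ! i)" by metis
  then have c: "\<And>k. k < nf_degree TYPE('a) \<Longrightarrow>
      \<gamma> ! k = (\<Sum>i<nf_degree TYPE('a). of_rat (of_int (c k ! i)) * \<omega> ! i)" by simp
  define M where "M = mat (nf_degree TYPE('a)) (nf_degree TYPE('a)) (\<lambda>(i, k). c k ! i)"
  have M: "mat (nf_degree TYPE('a)) (nf_degree TYPE('a)) (\<lambda>(i, k). of_int (c k ! i) :: rat) = map_mat of_int M"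
    by (rule eq_matI) (auto simp: M_def)
  have "det (embedding_mat \<gamma>) = det (embedding_mat \<omega>) * of_int (det M)"
    using det_embedding_mat_change[of \<gamma> "\<lambda>i k. of_int (c k ! i)" \<omega>, OF c]
    unfolding M by (simp add: of_int_hom.hom_det)
  then have "disc \<gamma> = of_int (det M) ^ 2 * field_disc TYPE('a)"
    by (simp add: fd disc_eq power_mult_distrib)
  then show "\<exists>z::int. disc \<gamma> = of_int z ^ 2 * field_disc TYPE('a)" by blast
qed


section \<open>Local degrees at archimedean places\<close>

definition embedding_abs :: "('a::number_field \<Rightarrow> complex) \<Rightarrow> 'a \<Rightarrow> real" where
  "embedding_abs \<sigma> x = cmod (\<sigma> x)"

text \<open>
  The real and the complex numbers as structures with a carrier, to compare them with a completion.
\<close>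

definition complex_subring :: "complex set \<Rightarrow> complex ring" where
  "complex_subring A = \<lparr>carrier = A, monoid.mult = (*), one = 1, zero = 0, add = (+)\<rparr>"

lemma complex_subring_simps [simp]:
  "carrier (complex_subring A) = A" "\<one>\<^bsub>complex_subring A\<^esub> = 1" "\<zero>\<^bsub>complex_subring A\<^esub> = 0"
  "x \<otimes>\<^bsub>complex_subring A\<^esub> y = x * y" "x \<oplus>\<^bsub>complex_subring A\<^esub> y = x + y"
  by (simp_all add: complex_subring_def)

lemma complex_subring_field:
  assumes A: "A = \<real> \<or> A = UNIV"
  shows "field (complex_subring A)"
proof -
  have mem: "1 \<in> A" "0 \<in> A" "\<And>x y. x \<in> A \<Longrightarrow> y \<in> A \<Longrightarrow> x + y \<in> A" "\<And>x y. x \<in> A \<Longrightarrow> y \<in> A \<Longrightarrow> x * y \<in> A"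
    "\<And>x. x \<in> A \<Longrightarrow> - x \<in> A" "\<And>x. x \<in> A \<Longrightarrow> inverse x \<in> A"
    using A by auto
  have "cring (complex_subring A)"
  proof (rule cringI)
    show "abelian_group (complex_subring A)"
    proof (rule abelian_groupI)
      fix x assume "x \<in> carrier (complex_subring A)"
      then show "\<exists>y\<in>carrier (complex_subring A). y \<oplus>\<^bsub>complex_subring A\<^esub> x = \<zero>\<^bsub>complex_subring A\<^esub>"
        using mem(5)[of x] by (intro bexI[of _ "- x"]) auto
    qed (use mem in \<open>auto simp: algebra_simps\<close>)
    show "comm_monoid (complex_subring A)"
      by (rule comm_monoidI) (use mem in \<open>auto simp: algebra_simps\<close>)
  qed (auto simp: algebra_simps)
  then interpret cring "complex_subring A" .
  show ?thesis
  proof (rule cring_fieldI2)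
    fix a assume "a \<in> carrier (complex_subring A)" "a \<noteq> \<zero>\<^bsub>complex_subring A\<^esub>"
    then show "\<exists>b\<in>carrier (complex_subring A). a \<otimes>\<^bsub>complex_subring A\<^esub> b = \<one>\<^bsub>complex_subring A\<^esub>"
      using mem(6)[of a] by (intro bexI[of _ "inverse a"]) auto
  qed simp
qed

lemma Reals_subfield_complex: "subfield \<real> (complex_subring UNIV)"
proof -
  interpret field "complex_subring UNIV" by (rule complex_subring_field) simp
  have minus: "\<ominus>\<^bsub>complex_subring UNIV\<^esub> x = - x" for x
    by (rule minus_equality) auto
  have "inv\<^bsub>complex_subring UNIV\<^esub> x = inverse x" if "x \<noteq> 0" for x
    using that by (intro inv_char) auto
  then show ?thesis
    by (intro subfieldI' subringI) (auto simp: minus)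
qed

lemma dimension_Reals_complex: "ring.dimension (complex_subring UNIV) 2 \<real> UNIV"
proof -
  interpret field "complex_subring UNIV" by (rule complex_subring_field) simp
  have "dimension 1 \<real> \<real>" by (rule dimension_one[OF Reals_subfield_complex])
  then have "dimension (Suc 1) \<real> (line_extension \<real> \<i> \<real>)"
    by (intro Suc_dim) (auto simp: complex_is_Real_iff)
  moreover have "z \<in> line_extension \<real> \<i> \<real>" for z
    unfolding line_extension_mem_iff
    by (intro bexI[of _ "complex_of_real (Im z)"] bexI[of _ "complex_of_real (Re z)"])
      (auto simp: complex_eq_iff)
  ultimately show ?thesis by (metis UNIV_eq_I Suc_1 One_nat_def)
qed

lemma dimension_Reals_Reals: "subfield \<real> (complex_subring \<real>)" "ring.dimension (complex_subring \<real>) 1 \<real> \<real>"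
proof -
  interpret field "complex_subring \<real>" by (rule complex_subring_field) simp
  show "subfield \<real> (complex_subring \<real>)" using carrier_is_subfield by simp
  then show "dimension 1 \<real> \<real>" by (rule dimension_one)
qed

lemma rational_sequence_tendsto:
  fixes r :: real
  obtains q :: "nat \<Rightarrow> rat" where "(\<lambda>i. of_rat (q i)) \<longlonglongrightarrow> r"
proof -
  have "\<exists>q. r - 1 / real (Suc i) < of_rat q \<and> of_rat q < r" for i
    by (rule of_rat_dense) simp
  then obtain q where q: "\<And>i. r - 1 / real (Suc i) < of_rat (q i)" "\<And>i. of_rat (q i) < r" by metis
  have "(\<lambda>i. of_rat (q i)) \<longlonglongrightarrow> r"
  proof (rule tendsto_sandwich)
    show "(\<lambda>i. r - 1 / real (Suc i)) \<longlonglongrightarrow> r"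
      using tendsto_diff[OF tendsto_const[of r] LIMSEQ_inverse_real_of_nat] by (simp add: inverse_eq_divide)
  qed (use q less_imp_le in \<open>auto intro!: always_eventually less_imp_le simp del: of_nat_Suc\<close>)
  then show ?thesis by (rule that)
qed

lemma complex_of_real_of_rat: "complex_of_real (of_rat q) = of_rat q"
  by (cases q) (simp add: of_rat_rat)

text \<open>
  An embedding identifies the completion at the place it induces with a field of complex
  numbers: the class of a Cauchy sequence is sent to the limit of the embedded sequence.  The local
  degree can therefore be read off in \<open>\<real>\<close> or \<open>\<complex>\<close>.
\<close>

locale archimedean =
  fixes \<sigma> :: "'a::number_field \<Rightarrow> complex"
  assumes \<sigma>: "\<sigma> \<in> embeddings"
begin

abbreviation R where "R \<equiv> cauchy_ring (embedding_abs \<sigma>)"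

definition limits :: "complex set" where
  "limits = {z. \<exists>s. (\<lambda>i. \<sigma> (s i)) \<longlonglongrightarrow> z}"

abbreviation T where "T \<equiv> complex_subring limits"

lemmas emb = embedding_rules[OF \<sigma>]

lemma carrier_R_iff: "s \<in> carrier R \<longleftrightarrow> (\<exists>z. (\<lambda>i. \<sigma> (s i)) \<longlonglongrightarrow> z)"
proof -
  have "s \<in> carrier R \<longleftrightarrow> Cauchy (\<lambda>i. \<sigma> (s i))"
    by (simp add: cauchy_ring_def Cauchy_def embedding_abs_def dist_norm emb)
  then show ?thesis by (simp add: Cauchy_convergent_iff convergent_def)
qed

lemma R_simps [simp]:
  "\<one>\<^bsub>R\<^esub> = (\<lambda>_. 1)" "\<zero>\<^bsub>R\<^esub> = (\<lambda>_. 0)" "s \<otimes>\<^bsub>R\<^esub> t = (\<lambda>i. s i * t i)" "s \<oplus>\<^bsub>R\<^esub> t = (\<lambda>i. s i + t i)"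
  by (simp_all add: cauchy_ring_def)

lemma R_cring: "cring R"
proof (rule cringI)
  show "abelian_group R"
  proof (rule abelian_groupI)
    fix s assume "s \<in> carrier R"
    then obtain z where "(\<lambda>i. \<sigma> (s i)) \<longlonglongrightarrow> z" by (auto simp: carrier_R_iff)
    then have "(\<lambda>i. \<sigma> (- s i)) \<longlonglongrightarrow> - z" by (simp add: emb tendsto_minus)
    then have "(\<lambda>i. - s i) \<in> carrier R" by (auto simp: carrier_R_iff)
    then show "\<exists>t\<in>carrier R. t \<oplus>\<^bsub>R\<^esub> s = \<zero>\<^bsub>R\<^esub>" by (intro bexI[of _ "\<lambda>i. - s i"]) auto
  next
    fix s t assume "s \<in> carrier R" "t \<in> carrier R"
    then obtain y z where "(\<lambda>i. \<sigma> (s i)) \<longlonglongrightarrow> y" "(\<lambda>i. \<sigma> (t i)) \<longlonglongrightarrow> z" by (auto simp: carrier_R_iff)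
    from tendsto_add[OF this] show "s \<oplus>\<^bsub>R\<^esub> t \<in> carrier R" by (auto simp: carrier_R_iff emb)
  next
    show "\<zero>\<^bsub>R\<^esub> \<in> carrier R" by (auto simp: carrier_R_iff)
  qed (auto simp: algebra_simps)
  show "comm_monoid R"
  proof (rule comm_monoidI)
    fix s t assume "s \<in> carrier R" "t \<in> carrier R"
    then obtain y z where "(\<lambda>i. \<sigma> (s i)) \<longlonglongrightarrow> y" "(\<lambda>i. \<sigma> (t i)) \<longlonglongrightarrow> z" by (auto simp: carrier_R_iff)
    from tendsto_mult[OF this] show "s \<otimes>\<^bsub>R\<^esub> t \<in> carrier R" by (auto simp: carrier_R_iff emb)
  next
    show "\<one>\<^bsub>R\<^esub> \<in> carrier R" by (auto simp: carrier_R_iff)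
  qed (auto simp: algebra_simps)
qed (auto simp: algebra_simps)

lemma rational_limits_dense:
  assumes "r \<in> \<real>"
  obtains q :: "nat \<Rightarrow> rat" where "(\<lambda>i. \<sigma> (of_rat (q i))) \<longlonglongrightarrow> r"
proof -
  obtain r' where r': "r = complex_of_real r'" using assms by (auto elim: Reals_cases)
  obtain q where "(\<lambda>i. of_rat (q i)) \<longlonglongrightarrow> r'" by (rule rational_sequence_tendsto)
  from tendsto_of_real[OF this, where 'a = complex] have "(\<lambda>i. \<sigma> (of_rat (q i))) \<longlonglongrightarrow> r"
    by (simp add: emb r' complex_of_real_of_rat)
  then show ?thesis by (rule that)
qed

text \<open>
  If some \<open>\<sigma>(x)\<close> is not real, then 1 and \<open>\<sigma>(x)\<close> form a real basis of \<open>\<complex>\<close>, and approximating both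
  coordinates by rational numbers reaches every complex number.
\<close>

lemma limits_eq: "limits = (if range \<sigma> \<subseteq> \<real> then \<real> else UNIV)"
proof (cases "range \<sigma> \<subseteq> \<real>")
  case True
  have "z \<in> \<real>" if z: "(\<lambda>i. \<sigma> (s i)) \<longlonglongrightarrow> z" for s z
  proof -
    have "(\<lambda>i. Im (\<sigma> (s i))) \<longlonglongrightarrow> Im z" using z by (rule tendsto_Im)
    moreover have "Im (\<sigma> (s i)) = 0" for i using True by (metis complex_is_Real_iff range_subsetD)
    ultimately have "Im z = 0" by (simp add: LIMSEQ_const_iff)
    then show ?thesis by (simp add: complex_is_Real_iff)
  qed
  then show ?thesis using True by (auto simp: limits_def elim: rational_limits_dense)
next
  case False
  then obtain x where "\<sigma> x \<notin> \<real>" by blast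
  then have x: "Im (\<sigma> x) \<noteq> 0" by (simp add: complex_is_Real_iff)
  have "z \<in> limits" for z
  proof -
    define b where "b = Im z / Im (\<sigma> x)"
    define a where "a = Re z - b * Re (\<sigma> x)"
    have z: "z = of_real a + of_real b * \<sigma> x" using x by (simp add: a_def b_def complex_eq_iff)
    obtain p where p: "(\<lambda>i. \<sigma> (of_rat (p i))) \<longlonglongrightarrow> of_real a" by (rule rational_limits_dense[OF Reals_of_real])
    obtain q where q: "(\<lambda>i. \<sigma> (of_rat (q i))) \<longlonglongrightarrow> of_real b" by (rule rational_limits_dense[OF Reals_of_real])
    from p q have "(\<lambda>i. \<sigma> (of_rat (p i)) + \<sigma> (of_rat (q i)) * \<sigma> x) \<longlonglongrightarrow> z"
      unfolding z by (intro tendsto_intros)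
    then have "(\<lambda>i. \<sigma> (of_rat (p i) + of_rat (q i) * x)) \<longlonglongrightarrow> z" by (simp only: emb)
    then show ?thesis unfolding limits_def mem_Collect_eq
      by (rule exI[of _ "\<lambda>i. of_rat (p i) + of_rat (q i) * x"])
  qed
  then show ?thesis using False by auto
qed

lemma T_field: "field T"
  by (rule complex_subring_field) (simp add: limits_eq)

definition seq_limit :: "(nat \<Rightarrow> 'a) \<Rightarrow> complex" where
  "seq_limit s = lim (\<lambda>i. \<sigma> (s i))"

lemma seq_limit_eq: "(\<lambda>i. \<sigma> (s i)) \<longlonglongrightarrow> z \<Longrightarrow> seq_limit s = z"
  by (simp add: seq_limit_def limI)

lemma seq_limit_tendsto: "s \<in> carrier R \<Longrightarrow> (\<lambda>i. \<sigma> (s i)) \<longlonglongrightarrow> seq_limit s"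
  using seq_limit_eq by (auto simp: carrier_R_iff)

lemma seq_limit_hom: "ring_hom_ring R T seq_limit"
proof (rule ring_hom_ringI2)
  show "ring R" using R_cring by (rule cring.axioms(1))
  show "ring T" using T_field by (meson cring.axioms(1) fieldE(1))
  show "seq_limit \<in> Ring.ring_hom R T"
  proof (rule ring_hom_memI)
    fix s t assume st: "s \<in> carrier R" "t \<in> carrier R"
    show "seq_limit s \<in> carrier T" using seq_limit_tendsto[OF st(1)] by (auto simp: limits_def)
    show "seq_limit (s \<otimes>\<^bsub>R\<^esub> t) = seq_limit s \<otimes>\<^bsub>T\<^esub> seq_limit t"
      using tendsto_mult[OF seq_limit_tendsto[OF st(1)] seq_limit_tendsto[OF st(2)]] by (simp add: seq_limit_eq emb)
    show "seq_limit (s \<oplus>\<^bsub>R\<^esub> t) = seq_limit s \<oplus>\<^bsub>T\<^esub> seq_limit t"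
      using tendsto_add[OF seq_limit_tendsto[OF st(1)] seq_limit_tendsto[OF st(2)]] by (simp add: seq_limit_eq emb)
  next
    show "seq_limit \<one>\<^bsub>R\<^esub> = \<one>\<^bsub>T\<^esub>" by (simp add: seq_limit_eq emb)
  qed
qed

lemma seq_limit_surj: "seq_limit ` carrier R = carrier T"
proof
  show "seq_limit ` carrier R \<subseteq> carrier T" using seq_limit_tendsto by (auto simp: limits_def)
  show "carrier T \<subseteq> seq_limit ` carrier R"
  proof
    fix z assume "z \<in> carrier T"
    then obtain s where s: "(\<lambda>i. \<sigma> (s i)) \<longlonglongrightarrow> z" by (auto simp: limits_def)
    then show "z \<in> seq_limit ` carrier R" by (intro image_eqI[of _ _ s]) (auto simp: seq_limit_eq carrier_R_iff)
  qed
qed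

lemma null_seqs_eq: "null_seqs (embedding_abs \<sigma>) = a_kernel R T seq_limit"
proof -
  have "s \<in> null_seqs (embedding_abs \<sigma>) \<longleftrightarrow> (\<lambda>i. \<sigma> (s i)) \<longlonglongrightarrow> 0" for s
    by (simp add: null_seqs_def embedding_abs_def tendsto_norm_zero_iff)
  then show ?thesis
    using seq_limit_tendsto seq_limit_eq carrier_R_iff by (auto simp: a_kernel_def')
qed

lemma completion_eq: "completion (embedding_abs \<sigma>) = R Quot a_kernel R T seq_limit"
  by (simp add: completion_def null_seqs_eq)

definition \<theta> :: "(nat \<Rightarrow> 'a) set \<Rightarrow> complex" where
  "\<theta> X = the_elem (seq_limit ` X)"

lemma \<theta>_iso: "\<theta> \<in> ring_iso (completion (embedding_abs \<sigma>)) T"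
  unfolding \<theta>_def[abs_def] completion_eq by (rule ring_hom_ring.FactRing_iso_set[OF seq_limit_hom seq_limit_surj])

lemma \<theta>_coset:
  assumes "s \<in> carrier R"
  shows "\<theta> (null_seqs (embedding_abs \<sigma>) +>\<^bsub>R\<^esub> s) = seq_limit s"
proof -
  interpret ring_hom_ring R T seq_limit by (rule seq_limit_hom)
  show ?thesis unfolding \<theta>_def null_seqs_eq using the_elem_simp[OF assms] by simp
qed

lemma \<theta>_rat_completion: "\<theta> ` rat_completion (embedding_abs \<sigma>) = \<real>"
proof
  show "\<theta> ` rat_completion (embedding_abs \<sigma>) \<subseteq> \<real>"
  proof
    fix z assume "z \<in> \<theta> ` rat_completion (embedding_abs \<sigma>)"
    then obtain s where s: "s \<in> carrier R" "range s \<subseteq> \<rat>" "z = seq_limit s"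
      by (auto simp: rat_completion_def \<theta>_coset)
    have "Im (\<sigma> (s i)) = 0" for i
    proof -
      obtain q where "s i = of_rat q" using s(2) by (metis Rats_cases range_subsetD)
      then show ?thesis by (metis emb(9) Im_complex_of_real complex_of_real_of_rat)
    qed
    moreover have "(\<lambda>i. Im (\<sigma> (s i))) \<longlonglongrightarrow> Im z" unfolding s(3) by (rule tendsto_Im[OF seq_limit_tendsto[OF s(1)]])
    ultimately show "z \<in> \<real>" by (simp add: LIMSEQ_const_iff complex_is_Real_iff)
  qed
  show "\<real> \<subseteq> \<theta> ` rat_completion (embedding_abs \<sigma>)"
  proof
    fix z :: complex assume "z \<in> \<real>"
    then obtain q where q: "(\<lambda>i. \<sigma> (of_rat (q i))) \<longlonglongrightarrow> z" by (rule rational_limits_dense)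
    define s where "s = (\<lambda>i. of_rat (q i) :: 'a)"
    have s: "s \<in> carrier R" "range s \<subseteq> \<rat>" "seq_limit s = z" using q by (auto simp: s_def carrier_R_iff seq_limit_eq)
    then have "null_seqs (embedding_abs \<sigma>) +>\<^bsub>R\<^esub> s \<in> rat_completion (embedding_abs \<sigma>)"
      unfolding rat_completion_def by blast
    then show "z \<in> \<theta> ` rat_completion (embedding_abs \<sigma>)" using s \<theta>_coset by (metis image_eqI)
  qed
qed

text \<open>
  The inverse of the isomorphism carries \<open>\<real>\<close> onto the completion of the rationals and \<open>limits\<close> onto the
  whole completion; an injective homomorphism preserves dimensions.  The completion of the rationals
  is a subfield, so the dimension is unique.
\<close>

lemma local_degree_eqI:
  assumes "subfield \<real> T" "ring.dimension T n \<real> limits"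
  shows "local_degree (embedding_abs \<sigma>) = n"
proof -
  let ?C = "completion (embedding_abs \<sigma>)"
  have cring_T: "cring T" using T_field by (rule fieldE(1))
  have "ideal (a_kernel R T seq_limit) R" by (rule ring_hom_ring.kernel_is_ideal[OF seq_limit_hom])
  then have ring_C: "ring ?C" unfolding completion_eq by (rule ideal.quotient_is_ring)
  have bij: "bij_betw \<theta> (carrier ?C) (carrier T)" using \<theta>_iso by (simp add: ring_iso_def)
  define \<psi> where "\<psi> = inv_into (carrier ?C) \<theta>"
  have \<psi>: "\<psi> \<in> ring_iso T ?C" unfolding \<psi>_def by (rule ring_iso_set_sym[OF ring_C \<theta>_iso])
  then have hom: "ring_hom_ring T ?C \<psi>"
    using cring.axioms(1)[OF cring_T] ring_C by (intro ring_hom_ringI2) (auto simp: ring_iso_def)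
  have sub: "rat_completion (embedding_abs \<sigma>) \<subseteq> carrier ?C"
    unfolding rat_completion_def completion_def FactRing_def A_RCOSETS_def' by auto
  have image_real: "\<psi> ` \<real> = rat_completion (embedding_abs \<sigma>)"
    unfolding \<theta>_rat_completion[symmetric] \<psi>_def
    using inv_into_image_cancel[OF bij_betw_imp_inj_on[OF bij] sub] .
  have image_T: "\<psi> ` limits = carrier ?C" "inj_on \<psi> limits"
    using \<psi> by (auto simp: ring_iso_def bij_betw_def)
  have ne: "\<one>\<^bsub>?C\<^esub> \<noteq> \<zero>\<^bsub>?C\<^esub>"
  proof -
    have "\<psi> 1 = \<one>\<^bsub>?C\<^esub>" "\<psi> 0 = \<zero>\<^bsub>?C\<^esub>"
      using ring_hom_one[OF ring_hom_ring.homh[OF hom]]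
        ring_hom_zero[OF ring_hom_ring.homh[OF hom] cring.axioms(1)[OF cring_T] ring_C] by simp_all
    moreover have "1 \<in> limits" "0 \<in> limits" by (auto simp: limits_eq)
    ultimately show ?thesis using image_T(2) by (metis inj_on_def zero_neq_one)
  qed
  have "ring.dimension ?C n (\<psi> ` \<real>) (\<psi> ` limits)"
    by (rule ring_hom_ring.inj_hom_dimension[OF hom assms(1) ne image_T(2) assms(2)])
  moreover have "subfield (\<psi> ` \<real>) ?C"
    by (rule ring_hom_ring.img_is_subfield(2)[OF hom assms(1) ne])
  ultimately show ?thesis
    unfolding local_degree_def image_real image_T(1)
    using ring.dimI[OF ring_C] by (metis over_def)
qed

theorem local_degree: "local_degree (embedding_abs \<sigma>) = (if range \<sigma> \<subseteq> \<real> then 1 else 2)"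
proof (cases "range \<sigma> \<subseteq> \<real>")
  case True
  then have "limits = \<real>" by (simp add: limits_eq)
  then show ?thesis using local_degree_eqI[of 1] dimension_Reals_Reals True by simp
next
  case False
  then have "limits = UNIV" by (simp add: limits_eq)
  then show ?thesis using local_degree_eqI[of 2] Reals_subfield_complex dimension_Reals_complex False by simp
qed

end


section \<open>Finiteness of the places where an element is large\<close>

lemma absolute_value_rules:
  assumes "absolute_value w"
  shows "w x \<ge> 0" "w x = 0 \<longleftrightarrow> x = 0" "w (x * y) = w x * w y" "w (x + y) \<le> w x + w y" "w 1 = 1"
    "w (- x) = w x" "w (x ^ n) = w x ^ n" "w (inverse x) = inverse (w x)" "w (x / y) = w x / w y"
proof -
  show mult: "w (x * y) = w x * w y" and zero: "w x = 0 \<longleftrightarrow> x = 0" and nonneg: "w x \<ge> 0"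
    and "w (x + y) \<le> w x + w y" for x y
    using assms by (auto simp: absolute_value_def)
  show one: "w 1 = 1" using mult[of 1 1] zero[of 1] by simp
  have "w (- 1) * w (- 1) = 1" using mult[of "-1" "-1"] one by simp
  then have "w (- 1) = 1" using nonneg[of "-1"]
    by (metis abs_of_nonneg real_sqrt_abs2 real_sqrt_one)
  then show "w (- x) = w x" using mult[of "-1" x] by simp
  show "w (x ^ n) = w x ^ n" by (induction n) (simp_all add: one mult)
  show inv: "w (inverse x) = inverse (w x)" for x
  proof (cases "x = 0")
    case False
    then have "w x * w (inverse x) = 1" by (simp add: mult[symmetric] one)
    then show ?thesis by (simp add: inverse_unique)
  qed (simp add: zero[THEN iffD2])
  show "w (x / y) = w x / w y" by (simp add: divide_inverse mult inv)
qed

lemma absolute_value_sum_le: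
  assumes "absolute_value w"
  shows "w (sum f A) \<le> (\<Sum>a\<in>A. w (f a))"
proof (induction A rule: infinite_finite_induct)
  case (insert a A)
  then show ?case using absolute_value_rules(4)[OF assms, of "f a" "sum f A"] by simp
qed (use absolute_value_rules(2)[OF assms, of 0] in auto)

text \<open>
  A rational number between \<open>a / l\<close> and \<open>b / l\<close>, with its denominator cleared.  With logarithms (up to sign) of
  absolute values for \<open>a\<close>, \<open>b\<close> and \<open>l\<close>, this compares powers of two elements.
\<close>

lemma integer_combination_between:
  fixes a b l :: real
  assumes "a < b" "l > 0"
  obtains k :: nat and m :: int where "k > 0" "real k * a < of_int m * l" "of_int m * l < real k * b"
proof -
  obtain r where r: "a / l < of_rat r" "of_rat r < b / l"
    using of_rat_dense[of "a / l" "b / l"] assms divide_strict_right_mono by blast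
  obtain m n where mn: "quotient_of r = (m, n)" by fastforce
  then have n: "n > 0" and q: "r = of_int m / of_int n"
    using quotient_of_div quotient_of_denom_pos by auto
  have "of_rat r = (of_int m / of_int n :: real)" by (simp add: q of_rat_divide)
  then have m: "of_int m * l = of_int n * (of_rat r * l)" using n by simp
  have "a < of_rat r * l" "of_rat r * l < b" using r assms(2) by (simp_all add: field_simps)
  then have "of_int n * a < of_int m * l" "of_int m * l < of_int n * b"
    unfolding m using n by simp_all
  then show ?thesis using that[of "nat n" m] n by simp
qed

text \<open>
  Start from \<open>x\<close> with \<open>w'(x) < w(x)\<close>.  Both absolute values agree at \<open>c\<close>, so some integral power of \<open>c\<close> has a
  common value that lies strictly between the values of a power of \<open>x\<close>, and the quotient separates.
\<close>

lemma absolute_values_separated: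
  fixes w w' :: "'a::field_char_0 \<Rightarrow> real"
  assumes w: "absolute_value w" and w': "absolute_value w'" and "w \<noteq> w'"
    and c: "w c = w' c" "0 < w c" "w c < 1"
  obtains y where "w y > 1" "w' y < 1"
proof -
  have "\<exists>x. x \<noteq> 0 \<and> w' x < w x"
  proof -
    obtain x where x: "w x \<noteq> w' x" using \<open>w \<noteq> w'\<close> by auto
    then have "x \<noteq> 0" using absolute_value_rules(2)[OF w] absolute_value_rules(2)[OF w'] by metis
    then have pos: "w x > 0" "w' x > 0"
      using absolute_value_rules(1,2)[OF w, of x] absolute_value_rules(1,2)[OF w', of x] by (simp_all add: less_le)
    show ?thesis
    proof (cases "w' x < w x")
      case False
      then have "w' (inverse x) < w (inverse x)"
        using x pos by (simp add: absolute_value_rules(8)[OF w] absolute_value_rules(8)[OF w'])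
      then show ?thesis using \<open>x \<noteq> 0\<close> by (intro exI[of _ "inverse x"]) simp
    qed (use \<open>x \<noteq> 0\<close> in blast)
  qed
  then obtain x where "x \<noteq> 0" and less: "w' x < w x" by blast
  then have pos: "w x > 0" "w' x > 0"
    using absolute_value_rules(1,2)[OF w, of x] absolute_value_rules(1,2)[OF w', of x] by (simp_all add: less_le)
  define l where "l = - ln (w c)"
  have l: "l > 0" "w c = exp (- l)" using c by (simp_all add: l_def)
  have "ln (w' x) < ln (w x)" using less pos by simp
  then obtain k m where k: "k > 0" "real k * ln (w' x) < of_int m * l" "of_int m * l < real k * ln (w x)"
    using integer_combination_between[OF _ l(1)] by blast
  define t where "t = (if m \<ge> 0 then c ^ nat m else inverse c ^ nat (- m))"
  have t: "v t = exp (- (of_int m * l))" if v: "absolute_value v" "v c = exp (- l)" for v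
    by (auto simp: t_def absolute_value_rules[OF v(1)] v(2) exp_of_nat_mult[symmetric] exp_minus[symmetric])
  have x: "v (x ^ k) = exp (real k * ln (v x))" if v: "absolute_value v" "v x > 0" for v
    using v(2) by (simp add: absolute_value_rules[OF v(1)] exp_of_nat_mult)
  have "w (x ^ k * t) = exp (real k * ln (w x) - of_int m * l)"
    using t[OF w l(2)] x[OF w pos(1)] by (simp add: absolute_value_rules(3)[OF w] exp_diff exp_minus divide_inverse)
  moreover have "w' (x ^ k * t) = exp (real k * ln (w' x) - of_int m * l)"
    using t[OF w'] l(2) c x[OF w' pos(2)] by (simp add: absolute_value_rules(3)[OF w'] exp_diff exp_minus divide_inverse)
  ultimately show ?thesis using that[of "x ^ k * t"] k by simp
qed

lemma eventually_power_gt: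
  fixes x :: real
  assumes "x > 1"
  shows "\<forall>\<^sub>F N in sequentially. x ^ N > K"
proof -
  obtain N0 where "x ^ N0 > K" using real_arch_pow[OF assms] by blast
  then have "x ^ N > K" if "N \<ge> N0" for N
    using power_increasing[OF that, of x] assms by (meson less_le_trans less_imp_le)
  then show ?thesis unfolding eventually_sequentially by blast
qed

text \<open>
  The usual induction.  If \<open>x\<close> serves for \<open>V\<close> and \<open>y\<close> separates \<open>w0\<close> from the new \<open>w\<close>, then \<open>x\<^sup>k y\<close> serves
  for large \<open>k\<close> if \<open>w(x) \<le> 1\<close>.  Otherwise \<open>y / (1 + x\<^sup>-\<^sup>k)\<close> does: its value tends to that of \<open>y\<close> where \<open>x\<close> is
  large, and to 0 where \<open>x\<close> is small.
\<close>

lemma weak_approximation: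
  fixes w0 :: "'a::field_char_0 \<Rightarrow> real"
  assumes w0: "absolute_value w0" and c: "0 < w0 c" "w0 c < 1"
    and "finite V" "\<And>w. w \<in> V \<Longrightarrow> absolute_value w" "\<And>w. w \<in> V \<Longrightarrow> w c = w0 c" "w0 \<notin> V"
  shows "\<exists>x. w0 x > 1 \<and> (\<forall>w\<in>V. w x < 1)"
  using assms(4-7)
proof (induction V rule: finite_induct)
  case empty
  have "w0 (inverse c) > 1" using c by (simp add: absolute_value_rules(8)[OF w0] one_less_inverse)
  then show ?case by blast
next
  case (insert w V)
  have w: "absolute_value w" using insert.prems by simp
  obtain x where x: "w0 x > 1" "\<And>v. v \<in> V \<Longrightarrow> v x < 1" using insert by auto
  have "w0 \<noteq> w" using insert.prems(3) by blast
  then obtain y where y: "w0 y > 1" "w y < 1"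
  proof (rule absolute_values_separated[OF w0 w _ _ c])
    show "w0 c = w c" using insert.prems(2)[of w] by simp
  qed blast
  have av: "absolute_value v" if "v \<in> V" for v using insert.prems(1) that by simp
  have "x \<noteq> 0" using x(1) absolute_value_rules(2)[OF w0, of x] by auto
  show ?case
  proof (cases "w x \<le> 1")
    case True
    have "\<forall>\<^sub>F k in sequentially. \<forall>v\<in>V. v (x ^ k * y) < 1"
    proof (rule eventually_ball_finite[OF insert.hyps(1)], intro ballI)
      fix v assume v: "v \<in> V"
      have "(\<lambda>k. v x ^ k * v y) \<longlonglongrightarrow> 0 * v y"
        using x(2)[OF v] absolute_value_rules(1)[OF av[OF v]]
        by (intro tendsto_mult tendsto_const LIMSEQ_realpow_zero) auto
      then have "\<forall>\<^sub>F k in sequentially. v x ^ k * v y < 1" by (intro order_tendstoD(2)[of _ 0]) auto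
      then show "\<forall>\<^sub>F k in sequentially. v (x ^ k * y) < 1"
        by (simp add: absolute_value_rules(3,7)[OF av[OF v]])
    qed
    then obtain k where k: "\<And>v. v \<in> V \<Longrightarrow> v (x ^ k * y) < 1"
      by (auto simp: eventually_sequentially)
    have "w (x ^ k * y) \<le> 1 * w y"
      unfolding absolute_value_rules(3,7)[OF w]
      using True absolute_value_rules(1)[OF w] by (intro mult_right_mono power_le_one) auto
    then have "w (x ^ k * y) < 1" using y(2) by simp
    moreover have "1 * 1 < w0 x ^ k * w0 y"
      using x(1) y(1) by (intro mult_le_less_imp_less) auto
    then have "w0 (x ^ k * y) > 1" by (simp add: absolute_value_rules(3,7)[OF w0])
    ultimately show ?thesis using k by (intro exI[of _ "x ^ k * y"]) blast
  next
    case False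
    define u where "u k = inverse x ^ k" for k
    have u: "v (u k) = inverse (v x) ^ k" if "absolute_value v" for v k
      by (simp add: u_def absolute_value_rules[OF that])
    have lower: "1 - v (u k) \<le> v (1 + u k)" "v (u k) - 1 \<le> v (1 + u k)" "v (1 + u k) \<le> 1 + v (u k)"
      if v: "absolute_value v" for v k
      using absolute_value_rules(4)[OF v, of "1 + u k" "- u k"] absolute_value_rules(4)[OF v, of "1 + u k" "- 1"]
        absolute_value_rules(4)[OF v, of 1 "u k"] absolute_value_rules(5,6)[OF v]
      by simp_all
    have tends: "(\<lambda>k. v (u k)) \<longlonglongrightarrow> 0" if v: "absolute_value v" "v x > 1" for v
      unfolding u[OF v(1)] using v(2) by (intro LIMSEQ_realpow_zero) (auto simp: inverse_less_1_iff)
    have 1: "\<forall>\<^sub>F k in sequentially. w0 (u k) < w0 y - 1"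
      using tends[OF w0 x(1)] y(1) by (intro order_tendstoD(2)[of _ 0]) auto
    have 2: "\<forall>\<^sub>F k in sequentially. w (u k) < 1 - w y"
      using tends[OF w] False y(2) by (intro order_tendstoD(2)[of _ 0]) auto
    have 3: "\<forall>\<^sub>F k in sequentially. \<forall>v\<in>V. v (u k) > 1 + v y"
    proof (rule eventually_ball_finite[OF insert.hyps(1)], intro ballI)
      fix v assume v: "v \<in> V"
      have "v x > 0" using \<open>x \<noteq> 0\<close> absolute_value_rules(1,2)[OF av[OF v], of x] by (simp add: less_le)
      then show "\<forall>\<^sub>F k in sequentially. v (u k) > 1 + v y"
        unfolding u[OF av[OF v]] using x(2)[OF v] by (intro eventually_power_gt) (simp add: one_less_inverse)
    qed
    obtain k where k: "w0 (u k) < w0 y - 1" "w (u k) < 1 - w y" "\<And>v. v \<in> V \<Longrightarrow> v (u k) > 1 + v y"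
      using eventually_conj[OF 1 eventually_conj[OF 2 3]] by (auto simp: eventually_sequentially)
    have nz: "1 + u k \<noteq> 0"
    proof
      assume "1 + u k = 0"
      then have "w (1 + u k) = 0" using absolute_value_rules(2)[OF w] by simp
      then show False using lower(1)[OF w, of k] k(2) absolute_value_rules(1)[OF w, of y] by simp
    qed
    have pos: "v (1 + u k) > 0" if "absolute_value v" for v
      using nz absolute_value_rules(1,2)[OF that, of "1 + u k"] by (simp add: less_le)
    have "w0 (y / (1 + u k)) > 1"
      using lower(3)[OF w0, of k] k(1) pos[OF w0] by (simp add: absolute_value_rules(9)[OF w0])
    moreover have "w (y / (1 + u k)) < 1"
      using lower(1)[OF w, of k] k(2) pos[OF w] by (simp add: absolute_value_rules(9)[OF w])
    moreover have "v (y / (1 + u k)) < 1" if v: "v \<in> V" for v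
      using lower(2)[OF av[OF v], of k] k(3)[OF v] pos[OF av[OF v]]
      by (simp add: absolute_value_rules(9)[OF av[OF v]])
    ultimately show ?thesis by (intro exI[of _ "y / (1 + u k)"]) blast
  qed
qed

text \<open>
  For each extension \<open>w\<close> take an element that is large at \<open>w\<close> and at most 1 at all the others; high powers make it
  larger than the number of extensions.  These elements are linearly independent over the rationals:
  in a relation, the term whose coefficient has the largest value dominates all others at its own
  absolute value.
\<close>

lemma card_extensions_le_degree:
  fixes W :: "('a::number_field \<Rightarrow> real) set"
  assumes W: "finite W" "\<And>w. w \<in> W \<Longrightarrow> absolute_value w" "\<And>w q. w \<in> W \<Longrightarrow> w (of_rat q) = v q"
    and c: "0 < v c" "v c < 1"
  shows "card W \<le> nf_degree TYPE('a)"
proof -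
  have "\<exists>x. w x > 1 \<and> (\<forall>w'\<in>W - {w}. w' x < 1)" if "w \<in> W" for w
  proof (rule weak_approximation[where c = "of_rat c"])
    show "absolute_value w" "0 < w (of_rat c)" "w (of_rat c) < 1" using that W(2,3) c by simp_all
    show "w' (of_rat c) = w (of_rat c)" if "w' \<in> W - {w}" for w'
      using that \<open>w \<in> W\<close> by (simp only: W(3) Diff_iff)
  qed (use W(1,2) in auto)
  then obtain x where x: "\<And>w. w \<in> W \<Longrightarrow> w (x w) > 1"
    "\<And>w w'. w \<in> W \<Longrightarrow> w' \<in> W \<Longrightarrow> w' \<noteq> w \<Longrightarrow> w' (x w) < 1" by (metis DiffI singletonD)
  have "\<forall>\<^sub>F N in sequentially. \<forall>w\<in>W. w (x w) ^ N > max 1 (real (card W))"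
  proof (rule eventually_ball_finite[OF W(1)], intro ballI)
    fix w assume "w \<in> W"
    then show "\<forall>\<^sub>F N in sequentially. w (x w) ^ N > max 1 (real (card W))"
      by (intro eventually_power_gt x(1))
  qed
  then obtain N where N: "\<And>w. w \<in> W \<Longrightarrow> w (x w) ^ N > max 1 (real (card W))"
    by (auto simp: eventually_sequentially simp del: max_less_iff_conj)
  define z where "z w = x w ^ N" for w
  have big: "w (z w) > 1" "w (z w) > real (card W)" if "w \<in> W" for w
    using N[OF that] absolute_value_rules(7)[OF W(2)[OF that]] by (simp_all add: z_def)
  have small: "w' (z w) \<le> 1" if "w \<in> W" "w' \<in> W" "w' \<noteq> w" for w w'
    unfolding z_def absolute_value_rules(7)[OF W(2)[OF that(2)]]
    using x(2)[OF that] absolute_value_rules(1)[OF W(2)[OF that(2)]] by (intro power_le_one) auto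
  have inj: "inj_on z W"
  proof (rule inj_onI, rule ccontr)
    fix w w' assume "w \<in> W" "w' \<in> W" "z w = z w'" "w \<noteq> w'"
    then show False using big(1)[of w] small[of w' w] by simp
  qed
  have "rat_vs.independent (z ` W)"
  proof (rule ccontr)
    assume "\<not> ?thesis"
    then obtain u where u: "(\<Sum>y\<in>z ` W. of_rat (u y) * y) = 0" "\<exists>y\<in>z ` W. u y \<noteq> 0"
      using rat_vs.dependent_finite[of "z ` W"] W(1) by auto
    have sum: "(\<Sum>w\<in>W. of_rat (u (z w)) * z w) = 0"
      using u(1) by (simp add: sum.reindex[OF inj])
    have "W \<noteq> {}" using u(2) by blast
    then have "Max ((\<lambda>w. v (u (z w))) ` W) \<in> (\<lambda>w. v (u (z w))) ` W"
      using W(1) by (intro Max_in) auto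
    then obtain w where w1: "w \<in> W" "Max ((\<lambda>w. v (u (z w))) ` W) = v (u (z w))" by blast
    have "v (u (z w')) \<le> v (u (z w))" if "w' \<in> W" for w'
      unfolding w1(2)[symmetric] using that W(1) by (intro Max_ge) auto
    note w = w1(1) this
    note av = W(2)[OF w(1)]
    have vpos: "v q \<ge> 0" "v q = 0 \<longleftrightarrow> q = 0" for q
      using absolute_value_rules(1,2)[OF av, of "of_rat q"] W(3)[OF w(1), of q] by auto
    have "v (u (z w)) \<noteq> 0"
    proof
      assume "v (u (z w)) = 0"
      then have "u (z w') = 0" if "w' \<in> W" for w' using w(2)[OF that] vpos by (metis order_antisym)
      then show False using u(2) by blast
    qed
    then have pos: "v (u (z w)) > 0" using vpos(1) by (simp add: less_le)
    have "of_rat (u (z w)) * z w = - (\<Sum>w'\<in>W - {w}. of_rat (u (z w')) * z w')"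
      using sum by (simp add: sum.remove[OF W(1) w(1)] eq_neg_iff_add_eq_0)
    then have "w (of_rat (u (z w)) * z w) = w (\<Sum>w'\<in>W - {w}. of_rat (u (z w')) * z w')"
      by (simp only: absolute_value_rules(6)[OF av])
    also have "\<dots> \<le> (\<Sum>w'\<in>W - {w}. w (of_rat (u (z w')) * z w'))" by (rule absolute_value_sum_le[OF av])
    also have "\<dots> \<le> (\<Sum>w'\<in>W - {w}. v (u (z w)) * 1)"
    proof (rule sum_mono)
      fix w' assume w': "w' \<in> W - {w}"
      then have "w (of_rat (u (z w')) * z w') = v (u (z w')) * w (z w')"
        using w(1) by (simp add: absolute_value_rules(3)[OF av] W(3))
      also have "\<dots> \<le> v (u (z w)) * 1"
        using w' w small[of w' w] vpos(1) absolute_value_rules(1)[OF av] by (intro mult_mono) auto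
      finally show "w (of_rat (u (z w')) * z w') \<le> v (u (z w)) * 1" .
    qed
    also have "\<dots> \<le> real (card W) * v (u (z w))"
      using w(1) W(1) pos by (simp add: card_Diff_singleton)
    also have "\<dots> < v (u (z w)) * w (z w)" using big(2)[OF w(1)] pos by simp
    also have "\<dots> = w (of_rat (u (z w)) * z w)" using w(1) by (simp add: absolute_value_rules(3)[OF av] W(3))
    finally show False by simp
  qed
  from rat_independent_finite(2)[OF this] show ?thesis by (simp add: card_image[OF inj])
qed

lemma finite_extensions:
  fixes v :: "rat \<Rightarrow> real"
  assumes "0 < v c" "v c < 1"
  shows "finite {w :: 'a::number_field \<Rightarrow> real. absolute_value w \<and> (\<forall>q. w (of_rat q) = v q)}"
    (is "finite ?S")
proof (rule ccontr)
  assume "infinite ?S"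
  then obtain W where "finite W" "card W = Suc (nf_degree TYPE('a))" "W \<subseteq> ?S"
    using infinite_arbitrarily_large by blast
  then show False using card_extensions_le_degree[of W v c] assms by auto
qed

lemma algebraic_int_powers_bounded_combination:
  fixes y :: "'b::field_char_0"
  assumes "algebraic_int y"
  obtains m where "\<And>N. \<exists>c. y ^ N = (\<Sum>i<m. of_int (c i) * y ^ i)"
proof -
  obtain m a where m: "m > 0" "y ^ m = (\<Sum>i<m. of_int (a i) * y ^ i)"
    using algebraic_int_top_power[OF assms] by metis
  obtain n where n: "m = Suc n" using m(1) gr0_implies_Suc by blast
  have "\<exists>c. y ^ N = (\<Sum>i<m. of_int (c i) * y ^ i)" for N
  proof (induction N)
    case 0
    have "y ^ 0 = (\<Sum>i<m. of_int (if i = 0 then 1 else 0) * y ^ i)"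
      unfolding n sum.lessThan_Suc_shift by simp
    then show ?case by (rule exI[of _ "\<lambda>i. if i = 0 then 1 else 0"])
  next
    case (Suc N)
    then obtain c where "y ^ N = (\<Sum>i<m. of_int (c i) * y ^ i)" by blast
    then have "y ^ Suc N = (\<Sum>i<n. of_int (c i) * y ^ Suc i) + of_int (c n) * y ^ m"
      by (simp add: n sum_distrib_left distrib_left mult_ac)
    also have "(\<Sum>i<n. of_int (c i) * y ^ Suc i) = (\<Sum>i<m. of_int (case i of 0 \<Rightarrow> 0 | Suc j \<Rightarrow> c j) * y ^ i)"
      unfolding n sum.lessThan_Suc_shift by simp
    also have "\<dots> + of_int (c n) * y ^ m
        = (\<Sum>i<m. of_int ((case i of 0 \<Rightarrow> 0 | Suc j \<Rightarrow> c j) + c n * a i) * y ^ i)"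
      unfolding m(2) by (simp add: sum_distrib_left sum.distrib[symmetric] algebra_simps)
    finally show ?case by (rule exI[of _ "\<lambda>i. (case i of 0 \<Rightarrow> 0 | Suc j \<Rightarrow> c j) + c n * a i"])
  qed
  then show ?thesis by (rule that)
qed

text \<open>
  Every power of \<open>y\<close> is an integral combination of the same finitely many powers, so its value is
  bounded independently of the exponent, which forces it to be at most 1.
\<close>

lemma absolute_value_algebraic_int_le_1:
  fixes y :: "'b::field_char_0"
  assumes w: "absolute_value w" and int: "\<And>k::int. w (of_int k) \<le> 1" and y: "algebraic_int y"
  shows "w y \<le> 1"
proof (rule ccontr)
  assume "\<not> ?thesis"
  then have gt: "w y > 1" by simp
  obtain m where m: "\<And>N. \<exists>c. y ^ N = (\<Sum>i<m. of_int (c i) * y ^ i)"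
    using algebraic_int_powers_bounded_combination[OF y] by blast
  have bound: "w y ^ N \<le> (\<Sum>i<m. w y ^ i)" for N
  proof -
    obtain c where c: "y ^ N = (\<Sum>i<m. of_int (c i) * y ^ i)" using m by blast
    have "w y ^ N = w (\<Sum>i<m. of_int (c i) * y ^ i)"
      unfolding c[symmetric] by (simp add: absolute_value_rules(7)[OF w])
    also have "\<dots> \<le> (\<Sum>i<m. w (of_int (c i) * y ^ i))" by (rule absolute_value_sum_le[OF w])
    also have "\<dots> \<le> (\<Sum>i<m. 1 * w y ^ i)"
      unfolding absolute_value_rules(3,7)[OF w]
      using int absolute_value_rules(1)[OF w] by (intro sum_mono mult_right_mono) auto
    finally show ?thesis by simp
  qed
  obtain N where "w y ^ N > (\<Sum>i<m. w y ^ i)" using real_arch_pow[OF gt] by blast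
  with bound[of N] show False by simp
qed

lemma padic_abs_of_int:
  assumes "prime p"
  shows "padic_abs p (of_int k) \<le> 1" "k \<noteq> 0 \<Longrightarrow> \<not> int p dvd k \<Longrightarrow> padic_abs p (of_int k) = 1"
    "padic_abs p (of_nat p) = 1 / real p"
proof -
  have p: "real p > 1" using prime_gt_1_nat[OF assms] by simp
  have eq: "padic_abs p (of_int k) = (if k = 0 then 0 else inverse (real p ^ multiplicity (int p) k))" for k
    by (simp add: padic_abs_def quotient_of_int power_int_minus)
  show "padic_abs p (of_int k) \<le> 1"
    unfolding eq using p by (simp add: inverse_le_1_iff)
  show "padic_abs p (of_int k) = 1" if "k \<noteq> 0" "\<not> int p dvd k"
    unfolding eq using that by (simp add: not_dvd_imp_multiplicity_0)
  show "padic_abs p (of_nat p) = 1 / real p"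
    using eq[of "int p"] p assms by (simp add: inverse_eq_divide)
qed

text \<open>
  Choose a nonzero integer \<open>k\<close> with \<open>kx\<close> integral.  At a place over a prime that does not divide \<open>k\<close>, the value of \<open>kx\<close> is
  at most 1 and that of \<open>k\<close> is 1.  Only the places over the finitely many prime divisors of \<open>k\<close> and the
  archimedean ones remain, and over each place of the rationals there are finitely many.
\<close>

lemma finite_places_gt_1:
  fixes x :: "'a::number_field"
  shows "finite {w \<in> places. w x > 1}"
proof -
  let ?E = "\<lambda>v. {w :: 'a \<Rightarrow> real. absolute_value w \<and> (\<forall>q. w (of_rat q) = v q)}"
  obtain k :: int where k: "k \<noteq> 0" "algebraic_int (of_int k * x)" using integral_multiple_exists by blast
  define P where "P = {p. prime p \<and> p dvd nat \<bar>k\<bar>}"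
  have "finite P" unfolding P_def using k(1) by (intro finite_subset[OF _ finite_divisors_nat[of "nat \<bar>k\<bar>"]]) auto
  have "w \<in> ?E (\<lambda>q. \<bar>of_rat q\<bar>) \<union> (\<Union>p\<in>P. ?E (padic_abs p))" if w: "w \<in> places" "w x > 1" for w
  proof (rule ccontr)
    assume not: "w \<notin> ?E (\<lambda>q. \<bar>of_rat q\<bar>) \<union> (\<Union>p\<in>P. ?E (padic_abs p))"
    have av: "absolute_value w" using w(1) by (simp add: places_def)
    then have "\<not> (\<forall>q. w (of_rat q) = \<bar>of_rat q\<bar>)" using not by simp
    then obtain p where p: "prime p" and wp: "\<forall>q. w (of_rat q) = padic_abs p q"
      using w(1) unfolding places_def by blast
    have "p \<notin> P" using not av wp by auto
    note p = p this
    have wint: "w (of_int j) = padic_abs p (of_int j)" for j using wp[rule_format, of "of_int j"] by simp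
    have "w (of_int k * x) \<le> 1"
      by (rule absolute_value_algebraic_int_le_1[OF av _ k(2)])
        (simp only: wint padic_abs_of_int(1)[OF p(1)])
    moreover have "\<not> int p dvd k" using p by (auto simp: P_def)
    then have "w (of_int k) = 1" using padic_abs_of_int(2)[OF p(1) k(1)] by (simp add: wint)
    ultimately show False using w(2) by (simp add: absolute_value_rules(3)[OF av])
  qed
  then have sub: "{w \<in> places. w x > 1} \<subseteq> ?E (\<lambda>q. \<bar>of_rat q\<bar>) \<union> (\<Union>p\<in>P. ?E (padic_abs p))" by blast
  have "finite (?E (\<lambda>q. \<bar>of_rat q\<bar>))"
    by (rule finite_extensions[where c = "1 / 2"]) (simp_all add: of_rat_divide)
  moreover have "finite (?E (padic_abs p))" if "p \<in> P" for p
  proof -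
    have "prime p" using that by (simp add: P_def)
    then show ?thesis using prime_gt_1_nat[of p]
      by (intro finite_extensions[where c = "of_nat p"]) (simp_all add: padic_abs_of_int(3))
  qed
  ultimately show ?thesis using \<open>finite P\<close> by (intro finite_subset[OF sub]) blast
qed


section \<open>Heights and embeddings\<close>

lemma embedding_abs_in_places:
  assumes "\<sigma> \<in> embeddings"
  shows "embedding_abs \<sigma> \<in> places"
proof -
  note emb = embedding_rules[OF assms]
  have "absolute_value (embedding_abs \<sigma>)"
    unfolding absolute_value_def embedding_abs_def
    by (simp add: emb norm_mult norm_triangle_ineq)
  moreover have "embedding_abs \<sigma> (of_rat q) = \<bar>of_rat q\<bar>" for q
    by (simp add: embedding_abs_def emb complex_of_real_of_rat[symmetric])
  ultimately show ?thesis by (simp add: places_def)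
qed

text \<open>
  Comparing the absolute values at \<open>x\<close> and \<open>x + 1\<close> shows that \<open>\<sigma>(x)\<close> and \<open>\<tau>(x)\<close> have equal real parts, hence are
  equal or conjugate.  The sets of \<open>x\<close> where they are equal and where they are conjugate are subgroups
  that cover \<open>K\<close>, so one of them is all of \<open>K\<close>.
\<close>

lemma embedding_abs_eq_imp:
  assumes \<sigma>: "\<sigma> \<in> embeddings" and \<tau>: "\<tau> \<in> embeddings" and eq: "embedding_abs \<sigma> = embedding_abs \<tau>"
  shows "\<tau> = \<sigma> \<or> \<tau> = (\<lambda>x. cnj (\<sigma> x))"
proof -
  note s = embedding_rules[OF \<sigma>] and t = embedding_rules[OF \<tau>]
  have norm_eq: "cmod (\<sigma> x) = cmod (\<tau> x)" for x using fun_cong[OF eq] by (simp add: embedding_abs_def)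
  have Re_eq: "Re (\<sigma> x) = Re (\<tau> x)" for x
  proof -
    have "(cmod (\<sigma> x))\<^sup>2 = (cmod (\<tau> x))\<^sup>2" "(cmod (\<sigma> (x + 1)))\<^sup>2 = (cmod (\<tau> (x + 1)))\<^sup>2"
      by (simp_all only: norm_eq)
    then show ?thesis
      by (simp only: s t cmod_power2 plus_complex.sel one_complex.sel) (simp add: power2_eq_square algebra_simps)
  qed
  have Im_eq: "Im (\<sigma> x) = Im (\<tau> x) \<or> Im (\<sigma> x) = - Im (\<tau> x)" for x
  proof -
    have "(cmod (\<sigma> x))\<^sup>2 = (cmod (\<tau> x))\<^sup>2" by (simp only: norm_eq)
    then have "(Im (\<sigma> x))\<^sup>2 = (Im (\<tau> x))\<^sup>2" by (simp add: cmod_power2 Re_eq)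
    then show ?thesis by (simp add: power2_eq_iff)
  qed
  show ?thesis
  proof (rule ccontr)
    assume "\<not> ?thesis"
    then obtain x y where xy: "\<tau> x \<noteq> \<sigma> x" "\<tau> y \<noteq> cnj (\<sigma> y)" by (metis ext)
    then have x: "Im (\<sigma> x) = - Im (\<tau> x)" "Im (\<tau> x) \<noteq> 0" and y: "Im (\<sigma> y) = Im (\<tau> y)" "Im (\<tau> y) \<noteq> 0"
      using Im_eq[of x] Im_eq[of y] Re_eq[of x] Re_eq[of y] by (auto simp: complex_eq_iff)
    have "Im (\<sigma> (x + y)) = Im (\<tau> y) - Im (\<tau> x)" "Im (\<tau> (x + y)) = Im (\<tau> y) + Im (\<tau> x)"
      using x y by (simp_all add: s t)
    with Im_eq[of "x + y"] x y show False by linarith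
  qed
qed

lemma card_embeddings_over_place:
  assumes \<sigma>: "\<sigma> \<in> (embeddings :: ('a::number_field \<Rightarrow> complex) set)"
  shows "card {\<tau> \<in> embeddings. embedding_abs \<tau> = embedding_abs \<sigma>} \<le> local_degree (embedding_abs \<sigma>)"
proof -
  interpret archimedean \<sigma> by unfold_locales (rule \<sigma>)
  let ?S = "{\<tau> \<in> embeddings. embedding_abs \<tau> = embedding_abs \<sigma>}"
  have sub: "?S \<subseteq> {\<sigma>, \<lambda>x. cnj (\<sigma> x)}" using embedding_abs_eq_imp[OF \<sigma>] by fastforce
  show ?thesis
  proof (cases "range \<sigma> \<subseteq> \<real>")
    case True
    then have "(\<lambda>x. cnj (\<sigma> x)) = \<sigma>" by (intro ext) (metis Reals_cnj_iff range_subsetD)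
    then have "?S \<subseteq> {\<sigma>}" using sub by simp
    then have "card ?S \<le> card {\<sigma>}" by (intro card_mono) auto
    then show ?thesis using True by (simp add: local_degree)
  next
    case False
    have "card ?S \<le> card {\<sigma>, \<lambda>x. cnj (\<sigma> x)}" using sub by (intro card_mono) auto
    also have "\<dots> \<le> 2" by (simp add: card_insert_if)
    finally show ?thesis using False by (simp add: local_degree)
  qed
qed

lemma local_height_ge_1: "local_height \<gamma> w \<ge> 1"
  unfolding local_height_def by (rule Max_ge) auto

text \<open>
  The product that defines the height would be 1 over an infinite set, so its lower bounds depend on this.
\<close>

lemma finite_local_height_neq_1:
  fixes \<gamma> :: "'a::number_field list"
  shows "finite {w \<in> places. local_height \<gamma> w \<noteq> 1}"
proof (rule finite_subset)
  show "finite (\<Union>x\<in>set \<gamma>. {w \<in> places. w x > 1})" by (simp add: finite_places_gt_1)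
  show "{w \<in> places. local_height \<gamma> w \<noteq> 1} \<subseteq> (\<Union>x\<in>set \<gamma>. {w \<in> places. w x > 1})"
  proof
    fix w assume w: "w \<in> {w \<in> places. local_height \<gamma> w \<noteq> 1}"
    then have nonneg: "w x \<ge> 0" for x by (auto simp: places_def absolute_value_def)
    show "w \<in> (\<Union>x\<in>set \<gamma>. {w \<in> places. w x > 1})"
    proof (rule ccontr)
      assume "\<not> ?thesis"
      then have "w x \<le> 1" if "x \<in> set \<gamma>" for x using w that by force
      then have "local_height \<gamma> w \<le> 1"
        unfolding local_height_def using nonneg by (intro Max.boundedI) (auto intro: power_le_one)
      then show False using w local_height_ge_1[of \<gamma> w] by simp
    qed
  qed
qed

definition embedding_max :: "'a::number_field list \<Rightarrow> ('a \<Rightarrow> complex) \<Rightarrow> real" where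
  "embedding_max \<gamma> \<sigma> = Max (insert 1 (embedding_abs \<sigma> ` set \<gamma>))"

lemma embedding_max_ge: "embedding_max \<gamma> \<sigma> \<ge> 1" "x \<in> set \<gamma> \<Longrightarrow> cmod (\<sigma> x) \<le> embedding_max \<gamma> \<sigma>"
  unfolding embedding_max_def by (auto intro!: Max_ge simp: embedding_abs_def)

lemma embedding_max_nonneg: "0 \<le> embedding_max \<gamma> \<sigma>"
  using embedding_max_ge(1)[of \<gamma> \<sigma>] by simp

text \<open>
  Grouped by the induced places, at most \<open>d\<^sub>w\<close> embeddings contribute the same factor
  \<open>max(1, w(\<gamma>\<^sub>1), w(\<gamma>\<^sub>2), \<dots>)\<close> at \<open>w\<close>, and the power of this factor to the exponent \<open>d\<^sub>w\<close> is the local height.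
\<close>

lemma prod_embedding_max_le_height:
  fixes \<gamma> :: "'a::number_field list"
  shows "(\<Prod>\<sigma>\<in>embeddings. embedding_max \<gamma> \<sigma>) \<le> height \<gamma>"
proof -
  let ?E = "embeddings :: ('a \<Rightarrow> complex) set"
  let ?W = "embedding_abs ` ?E"
  let ?A = "{w \<in> places. local_height \<gamma> w \<noteq> 1}"
  have "(\<Prod>\<sigma>\<in>?E. embedding_max \<gamma> \<sigma>)
      = (\<Prod>w\<in>?W. \<Prod>\<sigma>\<in>{\<sigma> \<in> ?E. embedding_abs \<sigma> = w}. embedding_max \<gamma> \<sigma>)"
    by (rule prod.group[symmetric]) (auto simp: finite_embeddings)
  also have "\<dots> \<le> (\<Prod>w\<in>?W. local_height \<gamma> w)"
  proof (rule prod_mono, intro conjI)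
    fix w assume "w \<in> ?W"
    then obtain \<sigma> where \<sigma>: "\<sigma> \<in> ?E" "w = embedding_abs \<sigma>" by blast
    let ?S = "{\<tau> \<in> ?E. embedding_abs \<tau> = w}"
    let ?m = "Max (insert 1 (w ` set \<gamma>))"
    have "(\<Prod>\<tau>\<in>?S. embedding_max \<gamma> \<tau>) = (\<Prod>\<tau>\<in>?S. ?m)"
      by (intro prod.cong) (auto simp: embedding_max_def)
    also have "\<dots> = ?m ^ card ?S" by simp
    also have "\<dots> \<le> ?m ^ local_degree w"
      using card_embeddings_over_place[OF \<sigma>(1)] \<sigma>(2) by (intro power_increasing) auto
    also have "\<dots> \<le> local_height \<gamma> w"
    proof -
      have "?m \<in> insert 1 (w ` set \<gamma>)" by (intro Max_in) auto
      then have "?m ^ local_degree w \<in> insert 1 ((\<lambda>x. w x ^ local_degree w) ` set \<gamma>)" by auto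
      then show ?thesis unfolding local_height_def by (intro Max_ge) auto
    qed
    finally show "(\<Prod>\<tau>\<in>?S. embedding_max \<gamma> \<tau>) \<le> local_height \<gamma> w" .
    show "0 \<le> (\<Prod>\<tau>\<in>?S. embedding_max \<gamma> \<tau>)"
      by (intro prod_nonneg embedding_max_nonneg)
  qed
  also have "\<dots> = (\<Prod>w\<in>?W \<inter> ?A. local_height \<gamma> w)"
    using embedding_abs_in_places by (intro prod.mono_neutral_right) (auto simp: finite_embeddings)
  also have "\<dots> \<le> (\<Prod>w\<in>?A. local_height \<gamma> w)"
    using finite_local_height_neq_1 local_height_ge_1
    by (intro prod_mono2) (auto intro: order_trans[OF zero_le_one])
  finally show ?thesis by (simp add: height_def)
qed

lemma height_ge_1: "height \<gamma> \<ge> 1"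
  unfolding height_def using local_height_ge_1 by (intro prod_ge_1) blast


section \<open>Bounding discriminants by heights\<close>

lemma det_embedding_mat_le:
  fixes \<gamma> :: "'a::number_field list"
  assumes bound: "\<And>\<sigma> x. \<sigma> \<in> embeddings \<Longrightarrow> x \<in> set \<gamma> \<Longrightarrow> cmod (\<sigma> x) \<le> B \<sigma>"
    and len: "length \<gamma> = nf_degree TYPE('a)"
  shows "cmod (det (embedding_mat \<gamma>)) \<le> fact (nf_degree TYPE('a)) * (\<Prod>\<sigma>\<in>embeddings. B \<sigma>)"
proof -
  let ?d = "nf_degree TYPE('a)"
  have "cmod (det (embedding_mat \<gamma>))
      \<le> (\<Sum>p\<in>{p. p permutes {0..<?d}}. cmod (signof p * (\<Prod>i = 0..<?d. embedding_mat \<gamma> $$ (i, p i))))"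
    unfolding det_def'[OF embedding_mat_carrier[of \<gamma>]] by (rule norm_sum)
  also have "\<dots> \<le> (\<Sum>p\<in>{p. p permutes {0..<?d}}. \<Prod>\<sigma>\<in>embeddings. B \<sigma>)"
  proof (rule sum_mono)
    fix p assume "p \<in> {p. p permutes {0..<?d}}"
    then have p: "p i < ?d" if "i < ?d" for i using that permutes_in_image[of p "{0..<?d}" i] by simp
    have "cmod (signof p * (\<Prod>i = 0..<?d. embedding_mat \<gamma> $$ (i, p i)))
        = (\<Prod>i = 0..<?d. cmod (nth_embedding i (\<gamma> ! p i)))"
      by (simp add: norm_mult sign_def prod_norm[symmetric] embedding_mat_index p)
    also have "\<dots> \<le> (\<Prod>i = 0..<?d. B (nth_embedding i))"
      using p len by (intro prod_mono conjI norm_ge_zero bound nth_embedding_mem nth_mem) auto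
    also have "\<dots> = (\<Prod>\<sigma>\<in>embeddings. B \<sigma>)"
      unfolding atLeast0LessThan by (rule prod.reindex_bij_betw[OF nth_embedding_bij])
    finally show "cmod (signof p * (\<Prod>i = 0..<?d. embedding_mat \<gamma> $$ (i, p i))) \<le> (\<Prod>\<sigma>\<in>embeddings. B \<sigma>)" .
  qed
  also have "\<dots> = fact ?d * (\<Prod>\<sigma>\<in>embeddings. B \<sigma>)"
    by (simp add: card_permutations)
  finally show ?thesis .
qed

lemma sqrt_disc: "sqrt (cmod (disc \<gamma>)) = cmod (det (embedding_mat \<gamma>))"
  by (simp add: disc_eq norm_power)

lemma disc_le_height:
  fixes \<gamma> :: "'a::number_field list"
  assumes "set \<delta> \<subseteq> set \<gamma>" "length \<delta> = nf_degree TYPE('a)"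
  shows "cmod (disc \<delta>) \<le> (fact (nf_degree TYPE('a)) * height \<gamma>)\<^sup>2"
proof -
  have "cmod (det (embedding_mat \<delta>)) \<le> fact (nf_degree TYPE('a)) * (\<Prod>\<sigma>\<in>embeddings. embedding_max \<gamma> \<sigma>)"
    using assms embedding_max_ge(2) by (intro det_embedding_mat_le) auto
  also have "\<dots> \<le> fact (nf_degree TYPE('a)) * height \<gamma>"
    using prod_embedding_max_le_height by (intro mult_left_mono) auto
  finally show ?thesis by (simp add: disc_eq norm_power power_mono)
qed

text \<open>
  A maximum over the union of two families is at most the product of the two maxima, as both are at least 1.
\<close>

lemma sqrt_disc_le_heights:
  fixes \<gamma> \<gamma>' :: "'a::number_field list"
  assumes "set \<delta> \<subseteq> set \<gamma> \<union> set \<gamma>'" "length \<delta> = nf_degree TYPE('a)"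
  shows "sqrt (cmod (disc \<delta>)) \<le> fact (nf_degree TYPE('a)) * height \<gamma> * height \<gamma>'"
proof -
  have "cmod (\<sigma> x) \<le> embedding_max \<gamma> \<sigma> * embedding_max \<gamma>' \<sigma>" if x: "x \<in> set \<delta>" for \<sigma> and x :: 'a
  proof -
    consider "x \<in> set \<gamma>" | "x \<in> set \<gamma>'" using x assms(1) by blast
    then show ?thesis
    proof cases
      case 1
      then have "cmod (\<sigma> x) * 1 \<le> embedding_max \<gamma> \<sigma> * embedding_max \<gamma>' \<sigma>"
        by (intro mult_mono embedding_max_ge embedding_max_nonneg) auto
      then show ?thesis by simp
    next
      case 2
      then have "1 * cmod (\<sigma> x) \<le> embedding_max \<gamma> \<sigma> * embedding_max \<gamma>' \<sigma>"
        by (intro mult_mono embedding_max_ge embedding_max_nonneg) auto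
      then show ?thesis by simp
    qed
  qed
  then have "cmod (det (embedding_mat \<delta>))
      \<le> fact (nf_degree TYPE('a)) * (\<Prod>\<sigma>\<in>embeddings. embedding_max \<gamma> \<sigma> * embedding_max \<gamma>' \<sigma>)"
    using assms(2) by (intro det_embedding_mat_le) auto
  also have "\<dots> = fact (nf_degree TYPE('a)) *
      ((\<Prod>\<sigma>\<in>embeddings. embedding_max \<gamma> \<sigma>) * (\<Prod>\<sigma>\<in>embeddings. embedding_max \<gamma>' \<sigma>))"
    by (simp add: prod.distrib)
  also have "\<dots> \<le> fact (nf_degree TYPE('a)) * (height \<gamma> * height \<gamma>')"
  proof (intro mult_left_mono mult_mono prod_embedding_max_le_height)
    show "0 \<le> height \<gamma>" using height_ge_1[of \<gamma>] by simp
    show "0 \<le> (\<Prod>\<sigma>\<in>embeddings. embedding_max \<gamma>' \<sigma>)"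
      by (intro prod_nonneg embedding_max_nonneg)
  qed simp
  finally show ?thesis by (simp add: sqrt_disc mult.assoc)
qed


section \<open>Vanishing, integrality and size of D and M\<close>

lemma finite_index_sets: "finite (index_sets m d)"
  unfolding index_sets_def by (rule finite_subset[of _ "Pow {..<m}"]) auto

lemma card_index_sets: "card (index_sets m d) = m choose d"
  unfolding index_sets_def using n_subsets[of "{..<m}" d] by simp

lemma index_sets_nonempty: "d \<le> m \<Longrightarrow> index_sets m d \<noteq> {}"
  by (metis card.empty card_index_sets binomial_eq_0_iff not_le)

lemma nths_index_set:
  assumes "I \<in> index_sets (length \<gamma>) d"
  shows "length (nths \<gamma> I) = d" "set (nths \<gamma> I) \<subseteq> set \<gamma>"
proof -
  have "{i. i < length \<gamma> \<and> i \<in> I} = I" "card I = d" using assms by (auto simp: index_sets_def)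
  then show "length (nths \<gamma> I) = d" by (simp add: length_nths)
qed (rule set_nths_subset)

text \<open>
  A spanning family contains a basis, and choosing one position for each basis element gives an index set.
\<close>

lemma all_disc_zero_iff:
  fixes \<gamma> :: "'a::number_field list"
  shows "(\<forall>I\<in>index_sets (length \<gamma>) (nf_degree TYPE('a)). disc (nths \<gamma> I) = 0)
    \<longleftrightarrow> rat_span (set \<gamma>) \<noteq> UNIV"
proof -
  let ?J = "index_sets (length \<gamma>) (nf_degree TYPE('a))"
  have "(\<exists>I\<in>?J. disc (nths \<gamma> I) \<noteq> 0) \<longleftrightarrow> rat_span (set \<gamma>) = UNIV"
  proof
    assume "\<exists>I\<in>?J. disc (nths \<gamma> I) \<noteq> 0"
    then obtain I where I: "I \<in> ?J" "disc (nths \<gamma> I) \<noteq> 0" by blast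
    have "rat_span (set (nths \<gamma> I)) = UNIV"
      using disc_nonzero_iff[OF nths_index_set(1)[OF I(1)]] I(2) by simp
    then show "rat_span (set \<gamma>) = UNIV"
      using rat_vs.span_mono[OF nths_index_set(2)[OF I(1)]] by blast
  next
    assume "rat_span (set \<gamma>) = UNIV"
    then obtain b where b: "rat_basis b" "set b \<subseteq> set \<gamma>" by (rule rat_basis_exists_within)
    have "\<forall>x\<in>set b. \<exists>i<length \<gamma>. \<gamma> ! i = x" using b(2) by (auto simp: in_set_conv_nth)
    then obtain f where f: "\<And>x. x \<in> set b \<Longrightarrow> f x < length \<gamma> \<and> \<gamma> ! f x = x" by metis
    define I where "I = f ` set b"
    have "inj_on f (set b)" using f by (metis inj_onI)
    then have "card I = nf_degree TYPE('a)"
      using b(1) length_rat_basis[OF b(1)] by (simp add: I_def card_image rat_basis_def distinct_card)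
    then have I: "I \<in> ?J" using f by (auto simp: index_sets_def I_def)
    have "set b \<subseteq> set (nths \<gamma> I)" using f by (force simp: set_nths I_def)
    then have "rat_span (set (nths \<gamma> I)) = UNIV"
      using rat_vs.span_mono b(1) unfolding rat_basis_def by blast
    then have "disc (nths \<gamma> I) \<noteq> 0" using disc_nonzero_iff[OF nths_index_set(1)[OF I]] by simp
    with I show "\<exists>I\<in>?J. disc (nths \<gamma> I) \<noteq> 0" by blast
  qed
  then show ?thesis by blast
qed

lemma calD_eq_0_iff:
  fixes \<alpha> :: "'a::number_field list"
  shows "calD \<alpha> = 0 \<longleftrightarrow> rat_span (set \<alpha>) \<noteq> UNIV"
proof -
  have "calD \<alpha> = 0 \<longleftrightarrow> (\<forall>I\<in>index_sets (length \<alpha>) (nf_degree TYPE('a)). disc (nths \<alpha> I) = 0)"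
    by (simp add: calD_def field_disc_nonzero sum_nonneg_eq_0_iff finite_index_sets)
  then show ?thesis by (simp only: all_disc_zero_iff)
qed

lemma calM_eq:
  fixes \<alpha> :: "'a::number_field list"
  assumes "length \<alpha> \<ge> nf_degree TYPE('a)"
  obtains I where "I \<in> index_sets (length (\<alpha> @ [\<beta>])) (nf_degree TYPE('a))"
    "calM \<alpha> \<beta> = sqrt (cmod (disc (nths (\<alpha> @ [\<beta>]) I))) / sqrt (cmod (field_disc TYPE('a)))"
    "\<And>J. J \<in> index_sets (length (\<alpha> @ [\<beta>])) (nf_degree TYPE('a)) \<Longrightarrow>
      sqrt (cmod (disc (nths (\<alpha> @ [\<beta>]) J))) \<le> sqrt (cmod (disc (nths (\<alpha> @ [\<beta>]) I)))"
proof -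
  let ?J = "index_sets (length \<alpha> + 1) (nf_degree TYPE('a))"
  let ?f = "\<lambda>I. sqrt (cmod (disc (nths (\<alpha> @ [\<beta>]) I)))"
  have "?J \<noteq> {}" using assms by (intro index_sets_nonempty) simp
  then have "Max (?f ` ?J) \<in> ?f ` ?J" by (intro Max_in) (auto simp: finite_index_sets)
  then obtain I where I: "I \<in> ?J" "Max (?f ` ?J) = ?f I" by blast
  have "?f J \<le> ?f I" if "J \<in> ?J" for J
    unfolding I(2)[symmetric] using that by (intro Max_ge) (auto simp: finite_index_sets)
  with I that[of I] show ?thesis by (simp add: calM_def)
qed

lemma calM_eq_0_iff:
  fixes \<alpha> :: "'a::number_field list"
  assumes "length \<alpha> \<ge> nf_degree TYPE('a)"
  shows "calM \<alpha> \<beta> = 0 \<longleftrightarrow> rat_span (set \<alpha> \<union> {\<beta>}) \<noteq> UNIV"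
proof -
  obtain I where I: "I \<in> index_sets (length (\<alpha> @ [\<beta>])) (nf_degree TYPE('a))"
    "calM \<alpha> \<beta> = sqrt (cmod (disc (nths (\<alpha> @ [\<beta>]) I))) / sqrt (cmod (field_disc TYPE('a)))"
    "\<And>J. J \<in> index_sets (length (\<alpha> @ [\<beta>])) (nf_degree TYPE('a)) \<Longrightarrow>
      sqrt (cmod (disc (nths (\<alpha> @ [\<beta>]) J))) \<le> sqrt (cmod (disc (nths (\<alpha> @ [\<beta>]) I)))"
    using calM_eq[OF assms] by blast
  have "calM \<alpha> \<beta> = 0 \<longleftrightarrow> disc (nths (\<alpha> @ [\<beta>]) I) = 0"
    by (simp add: I(2) field_disc_nonzero)
  also have "\<dots> \<longleftrightarrow> (\<forall>J\<in>index_sets (length (\<alpha> @ [\<beta>])) (nf_degree TYPE('a)). disc (nths (\<alpha> @ [\<beta>]) J) = 0)"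
    using I(1) I(3) by fastforce
  also have "\<dots> \<longleftrightarrow> rat_span (set \<alpha> \<union> {\<beta>}) \<noteq> UNIV"
    by (simp only: all_disc_zero_iff) simp
  finally show ?thesis .
qed

text \<open>
  Relative to an integral basis, this is the square of the determinant of an integer matrix.
\<close>

lemma normalized_disc_nat:
  fixes \<gamma> :: "'a::number_field list"
  assumes "I \<in> index_sets (length \<gamma>) (nf_degree TYPE('a))" "set \<gamma> \<subseteq> ring_of_integers"
  obtains m :: nat where "cmod (disc (nths \<gamma> I)) / cmod (field_disc TYPE('a)) = real m ^ 2"
proof -
  obtain z :: int where z: "disc (nths \<gamma> I) = of_int z ^ 2 * field_disc TYPE('a)"
    using disc_integral_multiple[OF nths_index_set(1)[OF assms(1)]] nths_index_set(2)[OF assms(1)] assms(2)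
    by blast
  have "cmod (disc (nths \<gamma> I)) / cmod (field_disc TYPE('a)) = real (nat \<bar>z\<bar>) ^ 2"
    by (simp add: z norm_mult norm_power field_disc_nonzero)
  then show ?thesis by (rule that)
qed

lemma calD_nat:
  fixes \<alpha> :: "'a::number_field list"
  assumes "set \<alpha> \<subseteq> ring_of_integers"
  shows "calD \<alpha> \<in> \<nat>"
proof -
  let ?J = "index_sets (length \<alpha>) (nf_degree TYPE('a))"
  have "\<forall>I\<in>?J. \<exists>m::nat. cmod (disc (nths \<alpha> I)) / cmod (field_disc TYPE('a)) = real m ^ 2"
    using normalized_disc_nat[OF _ assms] by blast
  then obtain m :: "nat set \<Rightarrow> nat" where
    m: "\<And>I. I \<in> ?J \<Longrightarrow> cmod (disc (nths \<alpha> I)) / cmod (field_disc TYPE('a)) = real (m I) ^ 2"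
    by metis
  have "calD \<alpha> = (\<Sum>I\<in>?J. cmod (disc (nths \<alpha> I)) / cmod (field_disc TYPE('a)))"
    by (simp add: calD_def sum_divide_distrib)
  also have "\<dots> = real (\<Sum>I\<in>?J. m I ^ 2)" by (simp add: m)
  finally show ?thesis by (simp only: of_nat_in_Nats)
qed

lemma calM_nat:
  fixes \<alpha> :: "'a::number_field list"
  assumes "length \<alpha> \<ge> nf_degree TYPE('a)" "set \<alpha> \<subseteq> ring_of_integers" "\<beta> \<in> ring_of_integers"
  shows "calM \<alpha> \<beta> \<in> \<nat>"
proof -
  obtain I where I: "I \<in> index_sets (length (\<alpha> @ [\<beta>])) (nf_degree TYPE('a))"
    "calM \<alpha> \<beta> = sqrt (cmod (disc (nths (\<alpha> @ [\<beta>]) I))) / sqrt (cmod (field_disc TYPE('a)))"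
    using calM_eq[OF assms(1)] by blast
  have "set (\<alpha> @ [\<beta>]) \<subseteq> ring_of_integers" using assms(2,3) by simp
  then obtain m :: nat where m: "cmod (disc (nths (\<alpha> @ [\<beta>]) I)) / cmod (field_disc TYPE('a)) = real m ^ 2"
    using normalized_disc_nat[OF I(1)] by blast
  have "calM \<alpha> \<beta> = sqrt (real m ^ 2)" unfolding I(2) m[symmetric] by (rule real_sqrt_divide[symmetric])
  then show ?thesis by simp
qed

lemma Nats_real_eq_0_or_ge_1: "x \<in> \<nat> \<Longrightarrow> x = 0 \<or> (x::real) \<ge> 1"
  by (auto elim!: Nats_cases)

lemma calD_le_height:
  fixes \<alpha> :: "'a::number_field list"
  shows "calD \<alpha> \<le> (fact (nf_degree TYPE('a)))\<^sup>2 / cmod (field_disc TYPE('a)) *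
    real (length \<alpha> choose nf_degree TYPE('a)) * (height \<alpha>)\<^sup>2"
proof -
  let ?d = "nf_degree TYPE('a)"
  have "(\<Sum>I\<in>index_sets (length \<alpha>) ?d. cmod (disc (nths \<alpha> I)))
      \<le> (\<Sum>I\<in>index_sets (length \<alpha>) ?d. (fact ?d * height \<alpha>)\<^sup>2)"
    by (intro sum_mono disc_le_height nths_index_set)
  also have "\<dots> = real (length \<alpha> choose ?d) * (fact ?d * height \<alpha>)\<^sup>2"
    by (simp add: card_index_sets)
  finally have "calD \<alpha> \<le> 1 / cmod (field_disc TYPE('a)) *
      (real (length \<alpha> choose ?d) * (fact ?d * height \<alpha>)\<^sup>2)"
    unfolding calD_def by (intro mult_left_mono) auto
  then show ?thesis by (simp add: power_mult_distrib mult_ac)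
qed

lemma calM_le_height:
  fixes \<alpha> :: "'a::number_field list"
  assumes "length \<alpha> \<ge> nf_degree TYPE('a)"
  shows "calM \<alpha> \<beta> \<le> fact (nf_degree TYPE('a)) / sqrt (cmod (field_disc TYPE('a))) * height \<alpha> * height [\<beta>]"
proof -
  obtain I where I: "I \<in> index_sets (length (\<alpha> @ [\<beta>])) (nf_degree TYPE('a))"
    "calM \<alpha> \<beta> = sqrt (cmod (disc (nths (\<alpha> @ [\<beta>]) I))) / sqrt (cmod (field_disc TYPE('a)))"
    using calM_eq[OF assms] by blast
  have "set (nths (\<alpha> @ [\<beta>]) I) \<subseteq> set \<alpha> \<union> set [\<beta>]"
    using nths_index_set(2)[OF I(1)] by auto
  from sqrt_disc_le_heights[OF this nths_index_set(1)[OF I(1)]]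
  have "calM \<alpha> \<beta> \<le> fact (nf_degree TYPE('a)) * height \<alpha> * height [\<beta>] / sqrt (cmod (field_disc TYPE('a)))"
    unfolding I(2) by (intro divide_right_mono) auto
  then show ?thesis by simp
qed

theorem lemma3p1:
  fixes \<alpha> :: "'a::number_field list" and \<beta> :: 'a and d n :: nat
  assumes "d = nf_degree TYPE('a)"
    and "n \<ge> d"
    and "length \<alpha> = n"
  shows
    "((calD \<alpha> = 0 \<longleftrightarrow> rat_span (set \<alpha>) \<noteq> UNIV) \<and>
      (calM \<alpha> \<beta> = 0 \<longleftrightarrow> rat_span (set \<alpha> \<union> {\<beta>}) \<noteq> UNIV)) \<and>
     (set \<alpha> \<subseteq> ring_of_integers \<longrightarrow>
        (calD \<alpha> = 0 \<or> calD \<alpha> \<ge> 1) \<and> calD \<alpha> \<in> \<nat> \<and>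
        (\<beta> \<in> ring_of_integers \<longrightarrow>
           (calM \<alpha> \<beta> = 0 \<or> calM \<alpha> \<beta> \<ge> 1) \<and> calM \<alpha> \<beta> \<in> \<nat>)) \<and>
     (calD \<alpha> \<le> (fact d)\<^sup>2 / cmod (field_disc TYPE('a)) * real (n choose d) * (height \<alpha>)\<^sup>2 \<and>
      calM \<alpha> \<beta> \<le> fact d / sqrt (cmod (field_disc TYPE('a))) * height \<alpha> * height [\<beta>])"

proof (intro conjI impI)
  have len: "length \<alpha> \<ge> nf_degree TYPE('a)" using assms by simp
  show "calD \<alpha> = 0 \<longleftrightarrow> rat_span (set \<alpha>) \<noteq> UNIV" by (rule calD_eq_0_iff)
  show "calM \<alpha> \<beta> = 0 \<longleftrightarrow> rat_span (set \<alpha> \<union> {\<beta>}) \<noteq> UNIV" by (rule calM_eq_0_iff[OF len])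
  show "calD \<alpha> \<le> (fact d)\<^sup>2 / cmod (field_disc TYPE('a)) * real (n choose d) * (height \<alpha>)\<^sup>2"
    using calD_le_height[of \<alpha>] assms by simp
  show "calM \<alpha> \<beta> \<le> fact d / sqrt (cmod (field_disc TYPE('a))) * height \<alpha> * height [\<beta>]"
    using calM_le_height[OF len] assms(1) by simp
  assume int: "set \<alpha> \<subseteq> ring_of_integers"
  show "calD \<alpha> \<in> \<nat>" by (rule calD_nat[OF int])
  then show "calD \<alpha> = 0 \<or> calD \<alpha> \<ge> 1" by (rule Nats_real_eq_0_or_ge_1)
  assume "\<beta> \<in> ring_of_integers"
  then show "calM \<alpha> \<beta> \<in> \<nat>" by (rule calM_nat[OF len int])
  then show "calM \<alpha> \<beta> = 0 \<or> calM \<alpha> \<beta> \<ge> 1" by (rule Nats_real_eq_0_or_ge_1)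
qed

end
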